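(* Let $\mathbb{F}$ be a field of characteristic $0$ and let $B(2)$ be the two-dimensional Lie algebra over $\mathbb{F}$ with basis $H,E$ and $[H,E]=E$. In the $t$-adically completed tensor product $U(B(2))[[t]]\,\widehat{\otimes}\,U(B(2))[[t]]$ let $\mathcal{F}_{\mathcal{J}}^{c}=\exp(H\otimes\ln(1+Et))$ be the canonical Jordanian twist. Then $$\mathcal{F}_{\mathcal{J}}^{c}=\sum_{r=0}^\infty\frac1{r!}H^{[r]}\otimes E^rt^r,\qquad(\mathcal{F}_{\mathcal{J}}^{c})^{-1}=\sum_{r=0}^\infty\frac{(-1)^r}{r!}H^{\langle r\rangle}\otimes E^rt^r,$$ and the twist $\mathcal{F}=\sum_{r=0}^\infty\frac{(-1)^r}{r!}H^{[r]}\otimes E^rt^r$ satisfies $$\mathcal{F}=\exp(H\otimes\ln(1-Et)).$$ Thus $\mathcal{F}$ and $\mathcal{F}_{\mathcal{J}}^{c}$ coincide up to an isomorphism of the carrier algebra: $\mathcal{F}=(\varphi\otimes\varphi)(\mathcal{F}_{\mathcal{J}}^{c})$ for the automorphism $\varphi$ of $B(2)$ with $\varphi(H)=H$, $\varphi(E)=-E$.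
   Context: $\exp(X)=\sum_{i\ge0}X^i/i!$ and $\ln(1+X)=\sum_{i\ge1}\frac{(-1)^{i+1}}{i}X^i$ as formal series. $x^{[r]}=x(x-1)\cdots(x-r+1)$ and $x^{\langle r\rangle}=x(x+1)\cdots(x+r-1)$ (both equal to $1$ for $r=0$). $U(\cdot)$ denotes the universal enveloping algebra. *)

theory Defs
  imports
    "HOL-Library.Poly_Mapping"
    "HOL-Library.Product_Plus"
    "HOL-Computational_Algebra.Formal_Power_Series"
begin

section \<open>Monoid algebras and quotients\<close>

text \<open>
  A monoid algebra is the type \<open>'m \<Rightarrow>\<^sub>0 'c\<close> of finitely supported maps, with the convolution
  product of \<^theory>\<open>HOL-Library.Poly_Mapping\<close>. That theory writes the monoid additively, hence
  the two additive instances below.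
\<close>

abbreviation "lookup \<equiv> Poly_Mapping.lookup"
abbreviation "keys \<equiv> Poly_Mapping.keys"
abbreviation "single \<equiv> Poly_Mapping.single"

datatype 'a word = Word "'a list"

primrec letters :: "'a word \<Rightarrow> 'a list" where
  "letters (Word xs) = xs"

instantiation word :: (type) monoid_add
begin
definition zero_word :: "'a word" where "zero_word = Word []"
definition plus_word :: "'a word \<Rightarrow> 'a word \<Rightarrow> 'a word"
  where "plus_word v w = Word (letters v @ letters w)"
instance
proof
  fix a b c :: "'a word"
  show "a + b + c = a + (b + c)" by (simp add: plus_word_def)
  show "0 + a = a" by (cases a) (simp add: plus_word_def zero_word_def)
  show "a + 0 = a" by (cases a) (simp add: plus_word_def zero_word_def)
qed
end

datatype ('a, 'b) mpair = MPair 'a 'b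

instantiation mpair :: (monoid_mult, monoid_mult) monoid_add
begin
definition zero_mpair :: "('a, 'b) mpair" where "zero_mpair = MPair 1 1"
fun plus_mpair :: "('a, 'b) mpair \<Rightarrow> ('a, 'b) mpair \<Rightarrow> ('a, 'b) mpair"
  where "plus_mpair (MPair a b) (MPair a' b') = MPair (a * a') (b * b')"
instance
proof
  fix a b c :: "('a, 'b) mpair"
  show "a + b + c = a + (b + c)" by (cases a; cases b; cases c) (simp add: mult.assoc)
  show "0 + a = a" by (cases a) (simp add: zero_mpair_def)
  show "a + 0 = a" by (cases a) (simp add: zero_mpair_def)
qed
end

abbreviation pm_scale :: "'c::comm_ring_1 \<Rightarrow> ('m::monoid_add \<Rightarrow>\<^sub>0 'c) \<Rightarrow> ('m \<Rightarrow>\<^sub>0 'c)"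
  where "pm_scale c p \<equiv> single 0 c * p"

lemma module_pm_scale: "module (pm_scale :: 'c::comm_ring_1 \<Rightarrow> ('m::monoid_add \<Rightarrow>\<^sub>0 'c) \<Rightarrow> _)"
  by unfold_locales
    (simp_all add: algebra_simps single_add mult_single mult.assoc[symmetric])

inductive_set two_sided_ideal :: "'r::ring_1 set \<Rightarrow> 'r set" for S where
  zero: "0 \<in> two_sided_ideal S"
| step: "x \<in> two_sided_ideal S \<Longrightarrow> s \<in> S \<Longrightarrow> x + a * s * b \<in> two_sided_ideal S"

lemma two_sided_ideal_add:
  assumes "x \<in> two_sided_ideal S" and "y \<in> two_sided_ideal S"
  shows "x + y \<in> two_sided_ideal S"
  using assms(2,1)
  by induction (auto simp: add.assoc[symmetric] intro: two_sided_ideal.step)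

lemma two_sided_ideal_mult:
  assumes "x \<in> two_sided_ideal S"
  shows "a * x * b \<in> two_sided_ideal S"
  using assms
proof induction
  case zero
  show ?case by (simp add: two_sided_ideal.zero)
next
  case (step x s c d)
  have "a * (x + c * s * d) * b = a * x * b + (a * c) * s * (d * b)"
    by (simp add: algebra_simps)
  with step show ?case by (metis two_sided_ideal.step)
qed

lemma two_sided_ideal_mult_left: "x \<in> two_sided_ideal S \<Longrightarrow> a * x \<in> two_sided_ideal S"
  using two_sided_ideal_mult[of x S a 1] by simp

lemma two_sided_ideal_mult_right: "x \<in> two_sided_ideal S \<Longrightarrow> x * b \<in> two_sided_ideal S"
  using two_sided_ideal_mult[of x S 1 b] by simp

lemma two_sided_ideal_uminus: "x \<in> two_sided_ideal S \<Longrightarrow> - x \<in> two_sided_ideal S"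
  using two_sided_ideal_mult_left[of x S "-1"] by simp

lemma two_sided_ideal_diff:
  "x \<in> two_sided_ideal S \<Longrightarrow> y \<in> two_sided_ideal S \<Longrightarrow> x - y \<in> two_sided_ideal S"
  using two_sided_ideal_add[of x S "- y"] two_sided_ideal_uminus by auto

definition pm_push :: "('m \<Rightarrow> 'n) \<Rightarrow> ('m \<Rightarrow>\<^sub>0 'c::comm_monoid_add) \<Rightarrow> ('n \<Rightarrow>\<^sub>0 'c)" where
  "pm_push f p = (\<Sum>x\<in>keys p. single (f x) (lookup p x))"

definition pm_eval :: "('m \<Rightarrow> 'c) \<Rightarrow> ('m \<Rightarrow>\<^sub>0 'c::comm_ring_1) \<Rightarrow> 'c" where
  "pm_eval g p = (\<Sum>x\<in>keys p. lookup p x * g x)"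

lemma pm_eval_superset:
  assumes "finite A" and "keys p \<subseteq> A"
  shows "pm_eval g p = (\<Sum>x\<in>A. lookup p x * g x)"
  unfolding pm_eval_def using assms
  by (intro sum.mono_neutral_left) (auto simp: in_keys_iff)

lemma pm_eval_add: "pm_eval g (p + q) = pm_eval g p + pm_eval g q"
proof -
  let ?A = "keys p \<union> keys q"
  have "pm_eval g (p + q) = (\<Sum>x\<in>?A. lookup (p + q) x * g x)"
    by (rule pm_eval_superset) (use keys_add[of p q] in auto)
  moreover have "pm_eval g p = (\<Sum>x\<in>?A. lookup p x * g x)"
    by (rule pm_eval_superset) auto
  moreover have "pm_eval g q = (\<Sum>x\<in>?A. lookup q x * g x)"
    by (rule pm_eval_superset) auto
  ultimately show ?thesis
    by (simp add: lookup_add distrib_right sum.distrib)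
qed

lemma pm_eval_zero [simp]: "pm_eval g 0 = 0"
  by (simp add: pm_eval_def)

lemma pm_eval_uminus: "pm_eval g (- p) = - pm_eval g p"
  using pm_eval_add[of g p "- p"] by (simp add: eq_neg_iff_add_eq_0 add.commute)

lemma pm_eval_diff: "pm_eval g (p - q) = pm_eval g p - pm_eval g q"
  using pm_eval_add[of g p "- q"] by (simp add: pm_eval_uminus)

lemma pm_eval_single [simp]: "pm_eval g (single x c) = c * g x"
  by (cases "c = 0") (simp_all add: pm_eval_def)

lemma lookup_pm_scale: "lookup (pm_scale c p) x = c * lookup p x"
proof -
  have "pm_scale c p = Poly_Mapping.map ((*) c) p"
    by (simp add: mult_map_scale_conv_mult)
  then show ?thesis by (simp add: Poly_Mapping.map.rep_eq when_def)
qed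

lemma pm_eval_scale: "pm_eval g (pm_scale c p) = c * pm_eval g p"
proof -
  have "pm_eval g (pm_scale c p) = (\<Sum>x\<in>keys p. lookup (pm_scale c p) x * g x)"
    by (rule pm_eval_superset) (auto simp: in_keys_iff lookup_pm_scale)
  then show ?thesis
    by (simp add: pm_eval_def lookup_pm_scale sum_distrib_left mult.assoc)
qed

lemma poly_mapping_sum_single:
  "p = (\<Sum>x\<in>keys p. single x (lookup p x))"
  by (rule poly_mapping_eqI)
    (auto simp: lookup_sum lookup_single when_def in_keys_iff sum.delta' if_distrib cong: if_cong)


section \<open>Lie algebras and universal enveloping algebras\<close>

locale lie_algebra = vector_space scale
  for scale :: "'k::field \<Rightarrow> 'g::ab_group_add \<Rightarrow> 'g" +
  fixes bracket :: "'g \<Rightarrow> 'g \<Rightarrow> 'g"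
  assumes bracket_add_left: "bracket (x + y) z = bracket x z + bracket y z"
    and bracket_add_right: "bracket x (y + z) = bracket x y + bracket x z"
    and bracket_scale_left: "bracket (scale c x) y = scale c (bracket x y)"
    and bracket_scale_right: "bracket x (scale c y) = scale c (bracket x y)"
    and bracket_self: "bracket x x = 0"
    and jacobi: "bracket x (bracket y z) + bracket y (bracket z x) + bracket z (bracket x y) = 0"

definition lie_automorphism ::
  "('k::field \<Rightarrow> 'g::ab_group_add \<Rightarrow> 'g) \<Rightarrow> ('g \<Rightarrow> 'g \<Rightarrow> 'g) \<Rightarrow> ('g \<Rightarrow> 'g) \<Rightarrow> bool" where
  "lie_automorphism scale bracket \<phi> \<longleftrightarrow>
     Vector_Spaces.linear scale scale \<phi> \<and> bij \<phi> \<and>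
     (\<forall>x y. \<phi> (bracket x y) = bracket (\<phi> x) (\<phi> y))"

text \<open>
  The free algebra on the underlying set of \<open>\<gg>\<close> modulo the first two families of relations is the
  tensor algebra \<open>T(\<gg>)\<close>; the third family cuts out \<open>U(\<gg>)\<close>.
\<close>

definition uea_relations ::
  "('k::field \<Rightarrow> 'g::ab_group_add \<Rightarrow> 'g) \<Rightarrow> ('g \<Rightarrow> 'g \<Rightarrow> 'g) \<Rightarrow> ('g word \<Rightarrow>\<^sub>0 'k) set" where
  "uea_relations scale bracket =
     {single (Word [x + y]) 1 - single (Word [x]) 1
        - single (Word [y]) 1 | x y. True} \<union>
     {single (Word [scale c x]) 1 - single (Word [x]) c | c x. True} \<union>
     {single (Word [x, y]) 1 - single (Word [y, x]) 1
        - single (Word [bracket x y]) 1 | x y. True}"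


section \<open>The Lie algebra \<open>B(2)\<close> and its enveloping algebra\<close>

text \<open>The pair \<open>(a, b)\<close> stands for \<open>a H + b E\<close>.\<close>

type_synonym 'k B2 = "'k \<times> 'k"

definition B2_scale :: "'k::field \<Rightarrow> 'k B2 \<Rightarrow> 'k B2" where
  "B2_scale c x = (c * fst x, c * snd x)"

definition B2_bracket :: "'k::field B2 \<Rightarrow> 'k B2 \<Rightarrow> 'k B2" where
  "B2_bracket x y = (0, fst x * snd y - snd x * fst y)"

definition B2_H :: "'k::field B2" where "B2_H = (1, 0)"
definition B2_E :: "'k::field B2" where "B2_E = (0, 1)"

lemma B2_lie_algebra: "lie_algebra B2_scale (B2_bracket :: 'k::field B2 \<Rightarrow> _)"
  by unfold_locales (auto simp: B2_scale_def B2_bracket_def algebra_simps prod_eq_iff)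

lemma B2_bracket_H_E: "B2_bracket B2_H B2_E = B2_E"
  by (simp add: B2_bracket_def B2_H_def B2_E_def)

lemma B2_basis: "\<exists>!(a, b). x = B2_scale a B2_H + B2_scale b B2_E"
  by (cases x) (auto simp: B2_scale_def B2_H_def B2_E_def)

definition UB2_eq :: "('k::field B2 word \<Rightarrow>\<^sub>0 'k) \<Rightarrow> ('k B2 word \<Rightarrow>\<^sub>0 'k) \<Rightarrow> bool" where
  "UB2_eq p q \<longleftrightarrow> p - q \<in> two_sided_ideal (uea_relations B2_scale B2_bracket)"

lemma UB2_eq_equivp: "equivp (UB2_eq :: ('k::field B2 word \<Rightarrow>\<^sub>0 'k) \<Rightarrow> _)"
proof (rule equivpI)
  show "reflp (UB2_eq :: ('k B2 word \<Rightarrow>\<^sub>0 'k) \<Rightarrow> _)"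
    by (auto simp: reflp_def UB2_eq_def two_sided_ideal.zero)
  show "symp (UB2_eq :: ('k B2 word \<Rightarrow>\<^sub>0 'k) \<Rightarrow> _)"
    unfolding symp_def UB2_eq_def
    by (intro allI impI) (drule two_sided_ideal_uminus, simp)
  show "transp (UB2_eq :: ('k B2 word \<Rightarrow>\<^sub>0 'k) \<Rightarrow> _)"
    unfolding transp_def UB2_eq_def
    by (intro allI impI) (drule (1) two_sided_ideal_add, simp)
qed

quotient_type (overloaded) 'k UB2 = "'k::field B2 word \<Rightarrow>\<^sub>0 'k" / UB2_eq
  by (rule UB2_eq_equivp)

text \<open>The constant term of a noncommutative polynomial is multiplicative and vanishes on the ideal.\<close>

lemma word_add_eq_0_iff: "v + w = 0 \<longleftrightarrow> v = 0 \<and> w = (0 :: 'a word)"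
  by (cases v; cases w) (simp add: plus_word_def zero_word_def)

lemma lookup_mult_word_0:
  fixes p q :: "'a word \<Rightarrow>\<^sub>0 'k::comm_ring_1"
  shows "lookup (p * q) 0 = lookup p 0 * lookup q 0"
proof -
  have "lookup (p * q) 0 = (\<Sum>l. lookup p l * (\<Sum>q'. lookup q q' when 0 = l + q'))"
    by (simp add: lookup_mult)
  also have "\<dots> = (\<Sum>l. lookup p l * lookup q 0 when l = 0)"
  proof (rule Sum_any.cong)
    fix l :: "'a word"
    have "(\<Sum>q'. lookup q q' when 0 = l + q') = (\<Sum>q'. (lookup q q' when l = 0) when q' = 0)"
      by (rule Sum_any.cong) (auto simp: when_def word_add_eq_0_iff eq_commute[of 0])
    also have "\<dots> = (lookup q 0 when l = 0)" by simp
    finally show "lookup p l * (\<Sum>q'. lookup q q' when 0 = l + q') = (lookup p l * lookup q 0 when l = 0)"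
      by (simp add: when_def)
  qed
  also have "\<dots> = lookup p 0 * lookup q 0" by simp
  finally show ?thesis .
qed

lemma uea_relations_lookup_0: "p \<in> uea_relations scale bracket \<Longrightarrow> lookup p 0 = 0"
  by (auto simp: uea_relations_def lookup_minus lookup_single zero_word_def when_def)

lemma uea_ideal_lookup_0:
  "p \<in> two_sided_ideal (uea_relations scale bracket) \<Longrightarrow> lookup p 0 = 0"
  by (induction rule: two_sided_ideal.induct)
    (simp_all add: lookup_add lookup_mult_word_0 uea_relations_lookup_0)

instantiation UB2 :: (field) ring_1
begin
lift_definition zero_UB2 :: "'a UB2" is 0 .
lift_definition one_UB2 :: "'a UB2" is 1 .
lift_definition plus_UB2 :: "'a UB2 \<Rightarrow> 'a UB2 \<Rightarrow> 'a UB2" is "(+)"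
  unfolding UB2_eq_def by (drule (1) two_sided_ideal_add) (simp add: algebra_simps)
lift_definition uminus_UB2 :: "'a UB2 \<Rightarrow> 'a UB2" is uminus
  unfolding UB2_eq_def by (drule two_sided_ideal_uminus) simp
lift_definition minus_UB2 :: "'a UB2 \<Rightarrow> 'a UB2 \<Rightarrow> 'a UB2" is "(-)"
  unfolding UB2_eq_def by (drule (1) two_sided_ideal_diff) (simp add: algebra_simps)
lift_definition times_UB2 :: "'a UB2 \<Rightarrow> 'a UB2 \<Rightarrow> 'a UB2" is "(*)"
proof -
  fix p p' q q' :: "'a B2 word \<Rightarrow>\<^sub>0 'a"
  assume a: "UB2_eq p p'" "UB2_eq q q'"
  have "p * q - p' * q' = (p - p') * q + p' * (q - q')" by (simp add: algebra_simps)
  with a show "UB2_eq (p * q) (p' * q')"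
    by (simp add: UB2_eq_def two_sided_ideal_add two_sided_ideal_mult_left
        two_sided_ideal_mult_right)
qed
instance
proof
  show "(0 :: 'a UB2) \<noteq> 1"
    by transfer (auto simp: UB2_eq_def dest: uea_ideal_lookup_0)
qed (transfer; simp add: UB2_eq_def algebra_simps two_sided_ideal.zero)+
end

lift_definition UB2_scalar :: "'k::field \<Rightarrow> 'k UB2" is "single 0" .

lift_definition UB2_incl :: "'k::field B2 \<Rightarrow> 'k UB2" is "\<lambda>x. single (Word [x]) 1" .

definition UB2_H :: "'k::field UB2" where "UB2_H = UB2_incl B2_H"
definition UB2_E :: "'k::field UB2" where "UB2_E = UB2_incl B2_E"

text \<open>The value does not depend on the representative when \<open>\<phi>\<close> is a Lie algebra homomorphism.\<close>

definition UB2_map :: "('k::field B2 \<Rightarrow> 'k B2) \<Rightarrow> 'k UB2 \<Rightarrow> 'k UB2" where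
  "UB2_map \<phi> = map_fun rep_UB2 abs_UB2 (pm_push (map_word \<phi>))"


section \<open>The tensor product of \<open>U(B(2))[[t]]\<close> with itself over \<open>\<bbbF>[[t]]\<close>\<close>

type_synonym 'k Ut = "'k UB2 fps"

definition Ut_scalar :: "'k::field fps \<Rightarrow> 'k Ut" where
  "Ut_scalar f = Abs_fps (\<lambda>n. UB2_scalar (fps_nth f n))"

definition Ut_map :: "('k::field B2 \<Rightarrow> 'k B2) \<Rightarrow> 'k Ut \<Rightarrow> 'k Ut" where
  "Ut_map \<phi> f = Abs_fps (\<lambda>n. UB2_map \<phi> (fps_nth f n))"

text \<open>
  \<open>A \<otimes> B\<close> is the free module on \<open>A \<times> B\<close> modulo the span of the following relations, where \<open>\<eta>\<close> and
  \<open>\<theta>\<close> are the structure maps of the algebras \<open>A\<close> and \<open>B\<close>.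
\<close>

definition tensor_relations ::
  "('c::comm_ring_1 \<Rightarrow> 'a::ring_1) \<Rightarrow> ('c \<Rightarrow> 'b::ring_1) \<Rightarrow> (('a, 'b) mpair \<Rightarrow>\<^sub>0 'c) set" where
  "tensor_relations \<eta> \<theta> =
     {single (MPair (a + a') b) 1 - single (MPair a b) 1 - single (MPair a' b) 1 | a a' b. True} \<union>
     {single (MPair a (b + b')) 1 - single (MPair a b) 1 - single (MPair a b') 1 | a b b'. True} \<union>
     {single (MPair (\<eta> c * a) b) 1 - single (MPair a b) c | c a b. True} \<union>
     {single (MPair a (\<theta> c * b)) 1 - single (MPair a b) c | c a b. True}"

definition tensor_null ::
  "('c::comm_ring_1 \<Rightarrow> 'a::ring_1) \<Rightarrow> ('c \<Rightarrow> 'b::ring_1) \<Rightarrow> (('a, 'b) mpair \<Rightarrow>\<^sub>0 'c) set" where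
  "tensor_null \<eta> \<theta> = module.span pm_scale (tensor_relations \<eta> \<theta>)"

interpretation pm: module "pm_scale :: 'c::comm_ring_1 \<Rightarrow> ('m::monoid_add \<Rightarrow>\<^sub>0 'c) \<Rightarrow> _"
  by (rule module_pm_scale)

lemma single_0_commute:
  fixes p :: "'m::monoid_add \<Rightarrow>\<^sub>0 'c::comm_ring_1"
  shows "p * single 0 c = single 0 c * p"
proof -
  have "(\<Sum>x\<in>keys p. single x (lookup p x)) * single 0 c
        = single 0 c * (\<Sum>x\<in>keys p. single x (lookup p x))"
    by (simp add: sum_distrib_left sum_distrib_right mult_single mult.commute)
  then show ?thesis by (simp add: poly_mapping_sum_single[symmetric])
qed

lemma tensor_relationsI:
  fixes \<eta> :: "'c::comm_ring_1 \<Rightarrow> 'a::ring_1" and \<theta> :: "'c \<Rightarrow> 'b::ring_1"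
  shows "single (MPair (a + a') b) 1 - single (MPair a b) 1 - single (MPair a' b) 1
           \<in> tensor_relations \<eta> \<theta>"
    and "single (MPair a (b + b')) 1 - single (MPair a b) 1 - single (MPair a b') 1
           \<in> tensor_relations \<eta> \<theta>"
    and "single (MPair (\<eta> c * a) b) 1 - single (MPair a b) c \<in> tensor_relations \<eta> \<theta>"
    and "single (MPair a (\<theta> c * b)) 1 - single (MPair a b) c \<in> tensor_relations \<eta> \<theta>"
  unfolding tensor_relations_def
  subgoal by (rule UnI1, rule UnI1, rule UnI1) blast
  subgoal by (rule UnI1, rule UnI1, rule UnI2) blast
  subgoal by (rule UnI1, rule UnI2) blast
  subgoal by (rule UnI2) blast
  done

lemma tensor_relationsE:
  fixes \<eta> :: "'c::comm_ring_1 \<Rightarrow> 'a::ring_1" and \<theta> :: "'c \<Rightarrow> 'b::ring_1"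
  assumes "s \<in> tensor_relations \<eta> \<theta>"
  obtains (add_left) a a' b
      where "s = single (MPair (a + a') b) 1 - single (MPair a b) 1 - single (MPair a' b) 1"
    | (add_right) a b b'
      where "s = single (MPair a (b + b')) 1 - single (MPair a b) 1 - single (MPair a b') 1"
    | (scale_left) c a b where "s = single (MPair (\<eta> c * a) b) 1 - single (MPair a b) c"
    | (scale_right) c a b where "s = single (MPair a (\<theta> c * b)) 1 - single (MPair a b) c"
  using assms unfolding tensor_relations_def by (elim UnE CollectE exE conjE) blast+

lemma tensor_relations_mult_left:
  assumes \<eta>: "\<And>c a. a * \<eta> c = \<eta> c * a" and \<theta>: "\<And>c b. b * \<theta> c = \<theta> c * b"
    and s: "s \<in> tensor_relations \<eta> \<theta>"
  shows "single m 1 * s \<in> tensor_relations \<eta> \<theta>"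
proof -
  obtain x y where m: "m = MPair x y" by (cases m)
  have l: "x * (\<eta> c * a) = \<eta> c * (x * a)" for c a
    by (metis \<eta> mult.assoc)
  have r: "y * (\<theta> c * b) = \<theta> c * (y * b)" for c b
    by (metis \<theta> mult.assoc)
  from s show ?thesis
    by (cases rule: tensor_relationsE)
      (simp_all only: m right_diff_distrib mult_single plus_mpair.simps distrib_left mult_1 l r
        tensor_relationsI)
qed

lemma tensor_relations_mult_right:
  assumes s: "s \<in> tensor_relations \<eta> \<theta>"
  shows "s * single m 1 \<in> tensor_relations \<eta> \<theta>"
proof -
  obtain x y where m: "m = MPair x y" by (cases m)
  from s show ?thesis
    by (cases rule: tensor_relationsE)
      (simp_all only: m left_diff_distrib mult_single plus_mpair.simps distrib_right mult_1
        mult_1_right mult.assoc tensor_relationsI)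
qed

lemma tensor_null_mult_left:
  assumes "\<And>c a. a * \<eta> c = \<eta> c * a" and "\<And>c b. b * \<theta> c = \<theta> c * b"
    and "p \<in> tensor_null \<eta> \<theta>"
  shows "r * p \<in> tensor_null \<eta> \<theta>"
  using assms(3) unfolding tensor_null_def
proof (induction rule: pm.span_induct_alt)
  case base
  show ?case by (simp add: pm.span_zero)
next
  case (step c s q)
  have eq: "single m d * s = pm_scale d (single m 1 * s)" for m d
    by (simp add: mult.assoc[symmetric] mult_single)
  have "single m d * s \<in> pm.span (tensor_relations \<eta> \<theta>)" for m d
    by (subst eq) (intro pm.span_scale pm.span_base tensor_relations_mult_left assms step(1))
  then have "(\<Sum>x\<in>keys r. single x (lookup r x) * s) \<in> pm.span (tensor_relations \<eta> \<theta>)"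
    by (intro pm.span_sum)
  then have "r * s \<in> pm.span (tensor_relations \<eta> \<theta>)"
    by (simp only: sum_distrib_right[symmetric] poly_mapping_sum_single[symmetric])
  moreover have "r * (pm_scale c s + q) = pm_scale c (r * s) + r * q"
    by (simp add: distrib_left mult.assoc[symmetric] single_0_commute)
  ultimately show ?case using step by (simp add: pm.span_add pm.span_scale)
qed

lemma tensor_null_mult_right:
  assumes "p \<in> tensor_null \<eta> \<theta>"
  shows "p * r \<in> tensor_null \<eta> \<theta>"
  using assms unfolding tensor_null_def
proof (induction rule: pm.span_induct_alt)
  case base
  show ?case by (simp add: pm.span_zero)
next
  case (step c s q)
  have eq: "s * single m d = pm_scale d (s * single m 1)" for m d
    by (simp add: single_0_commute[symmetric] mult.assoc mult_single)
  have "s * single m d \<in> pm.span (tensor_relations \<eta> \<theta>)" for m d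
    by (subst eq) (intro pm.span_scale pm.span_base tensor_relations_mult_right step(1))
  then have "(\<Sum>x\<in>keys r. s * single x (lookup r x)) \<in> pm.span (tensor_relations \<eta> \<theta>)"
    by (intro pm.span_sum)
  then have "s * r \<in> pm.span (tensor_relations \<eta> \<theta>)"
    by (simp only: sum_distrib_left[symmetric] poly_mapping_sum_single[symmetric])
  moreover have "(pm_scale c s + q) * r = pm_scale c (s * r) + q * r"
    by (simp add: distrib_right mult.assoc)
  ultimately show ?case using step by (simp add: pm.span_add pm.span_scale)
qed

lemma UB2_scalar_commute: "x * UB2_scalar c = UB2_scalar c * x"
  by transfer (simp add: single_0_commute UB2_eq_def two_sided_ideal.zero)

lemma Ut_scalar_commute: "f * Ut_scalar c = Ut_scalar c * f"
proof (rule fps_ext)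
  fix n
  have "fps_nth (f * Ut_scalar c) n = (\<Sum>i=0..n. UB2_scalar (fps_nth c (n - i)) * fps_nth f i)"
    by (simp add: fps_mult_nth Ut_scalar_def UB2_scalar_commute)
  also have "\<dots> = (\<Sum>i=0..n. UB2_scalar (fps_nth c i) * fps_nth f (n - i))"
    by (subst sum.atLeastAtMost_rev) (auto intro!: sum.cong)
  also have "\<dots> = fps_nth (Ut_scalar c * f) n"
    by (simp add: fps_mult_nth Ut_scalar_def)
  finally show "fps_nth (f * Ut_scalar c) n = fps_nth (Ut_scalar c * f) n" .
qed

definition Utensor_eq ::
  "(('k::field Ut, 'k Ut) mpair \<Rightarrow>\<^sub>0 'k fps) \<Rightarrow> (('k Ut, 'k Ut) mpair \<Rightarrow>\<^sub>0 'k fps) \<Rightarrow> bool" where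
  "Utensor_eq p q \<longleftrightarrow> p - q \<in> tensor_null Ut_scalar Ut_scalar"

lemma Utensor_null:
  shows Utensor_null_zero: "0 \<in> tensor_null Ut_scalar Ut_scalar"
    and Utensor_null_add: "\<And>p q. p \<in> tensor_null Ut_scalar Ut_scalar \<Longrightarrow>
          q \<in> tensor_null Ut_scalar Ut_scalar \<Longrightarrow> p + q \<in> tensor_null Ut_scalar Ut_scalar"
    and Utensor_null_diff: "\<And>p q. p \<in> tensor_null Ut_scalar Ut_scalar \<Longrightarrow>
          q \<in> tensor_null Ut_scalar Ut_scalar \<Longrightarrow> p - q \<in> tensor_null Ut_scalar Ut_scalar"
    and Utensor_null_uminus: "\<And>p. p \<in> tensor_null Ut_scalar Ut_scalar \<Longrightarrow>
          - p \<in> tensor_null Ut_scalar Ut_scalar"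
    and Utensor_null_mult_left: "\<And>p r. p \<in> tensor_null Ut_scalar Ut_scalar \<Longrightarrow>
          r * p \<in> tensor_null Ut_scalar Ut_scalar"
    and Utensor_null_mult_right: "\<And>p r. p \<in> tensor_null Ut_scalar Ut_scalar \<Longrightarrow>
          p * r \<in> tensor_null Ut_scalar Ut_scalar"
  by (simp_all add: tensor_null_mult_left tensor_null_mult_right Ut_scalar_commute)
    (simp_all add: tensor_null_def pm.span_zero pm.span_add pm.span_diff pm.span_neg)

lemma Utensor_eq_equivp:
  "equivp (Utensor_eq :: (('k::field Ut, 'k Ut) mpair \<Rightarrow>\<^sub>0 'k fps) \<Rightarrow> _)"
proof (rule equivpI)
  show "reflp (Utensor_eq :: (('k Ut, 'k Ut) mpair \<Rightarrow>\<^sub>0 'k fps) \<Rightarrow> _)"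
    by (auto simp: reflp_def Utensor_eq_def Utensor_null_zero)
  show "symp (Utensor_eq :: (('k Ut, 'k Ut) mpair \<Rightarrow>\<^sub>0 'k fps) \<Rightarrow> _)"
    unfolding symp_def Utensor_eq_def
    by (intro allI impI) (drule Utensor_null_uminus, simp)
  show "transp (Utensor_eq :: (('k Ut, 'k Ut) mpair \<Rightarrow>\<^sub>0 'k fps) \<Rightarrow> _)"
    unfolding transp_def Utensor_eq_def
    by (intro allI impI) (drule (1) Utensor_null_add, simp)
qed

quotient_type (overloaded) 'k Utensor = "('k::field Ut, 'k Ut) mpair \<Rightarrow>\<^sub>0 'k fps" / Utensor_eq
  by (rule Utensor_eq_equivp)

text \<open>The counit shows that the tensor product and its completion are nontrivial rings.\<close>

lift_definition UB2_counit :: "'k::field UB2 \<Rightarrow> 'k" is "\<lambda>p. lookup p 0"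
  by (auto simp: UB2_eq_def lookup_minus dest: uea_ideal_lookup_0)

lemma UB2_counit_simps [simp]:
  "UB2_counit 0 = 0" "UB2_counit 1 = 1" "UB2_counit (x + y) = UB2_counit x + UB2_counit y"
  "UB2_counit (x * y) = UB2_counit x * UB2_counit y" "UB2_counit (UB2_scalar c) = c"
  by (transfer; simp add: lookup_add lookup_mult_word_0)+

lemma UB2_counit_sum: "UB2_counit (sum f A) = (\<Sum>x\<in>A. UB2_counit (f x))"
  by (induction A rule: infinite_finite_induct) simp_all

definition Ut_counit :: "'k::field Ut \<Rightarrow> 'k fps" where
  "Ut_counit f = Abs_fps (\<lambda>n. UB2_counit (fps_nth f n))"

lemma Ut_counit_simps [simp]:
  "Ut_counit 1 = 1" "Ut_counit (f + g) = Ut_counit f + Ut_counit g"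
  "Ut_counit (f * g) = Ut_counit f * Ut_counit g" "Ut_counit (Ut_scalar c) = c"
  by (auto intro!: fps_ext simp: Ut_counit_def Ut_scalar_def fps_mult_nth UB2_counit_sum)

definition pair_counit :: "(('k::field Ut, 'k Ut) mpair \<Rightarrow>\<^sub>0 'k fps) \<Rightarrow> 'k fps" where
  "pair_counit = pm_eval (\<lambda>m. case m of MPair a b \<Rightarrow> Ut_counit a * Ut_counit b)"

lemma pair_counit_relations: "s \<in> tensor_relations Ut_scalar Ut_scalar \<Longrightarrow> pair_counit s = 0"
  by (erule tensor_relationsE)
    (simp_all add: pair_counit_def pm_eval_diff distrib_left distrib_right mult.assoc
      mult.left_commute)

lemma pair_counit_null: "p \<in> tensor_null Ut_scalar Ut_scalar \<Longrightarrow> pair_counit p = 0"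
  unfolding tensor_null_def
proof (induction rule: pm.span_induct_alt)
  case base
  show ?case by (simp add: pair_counit_def)
next
  case (step c s q)
  then show ?case
    using pair_counit_relations[of s] by (simp add: pair_counit_def pm_eval_add pm_eval_scale)
qed

lemma pair_counit_one: "pair_counit 1 = 1"
  by (simp add: pair_counit_def single_one[symmetric] zero_mpair_def del: single_one)

instantiation Utensor :: (field) ring_1
begin
lift_definition zero_Utensor :: "'a Utensor" is 0 .
lift_definition one_Utensor :: "'a Utensor" is 1 .
lift_definition plus_Utensor :: "'a Utensor \<Rightarrow> 'a Utensor \<Rightarrow> 'a Utensor" is "(+)"
  unfolding Utensor_eq_def by (drule (1) Utensor_null_add) (simp add: algebra_simps)
lift_definition uminus_Utensor :: "'a Utensor \<Rightarrow> 'a Utensor" is uminus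
  unfolding Utensor_eq_def by (drule Utensor_null_uminus) simp
lift_definition minus_Utensor :: "'a Utensor \<Rightarrow> 'a Utensor \<Rightarrow> 'a Utensor" is "(-)"
  unfolding Utensor_eq_def by (drule (1) Utensor_null_diff) (simp add: algebra_simps)
lift_definition times_Utensor :: "'a Utensor \<Rightarrow> 'a Utensor \<Rightarrow> 'a Utensor" is "(*)"
proof -
  fix p p' q q' :: "('a Ut, 'a Ut) mpair \<Rightarrow>\<^sub>0 'a fps"
  assume a: "Utensor_eq p p'" "Utensor_eq q q'"
  have "p * q - p' * q' = (p - p') * q + p' * (q - q')" by (simp add: algebra_simps)
  with a show "Utensor_eq (p * q) (p' * q')"
    by (simp add: Utensor_eq_def Utensor_null_add Utensor_null_mult_left Utensor_null_mult_right)
qed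
instance
proof
  show "(0 :: 'a Utensor) \<noteq> 1"
  proof transfer
    show "\<not> Utensor_eq 0 (1 :: ('a Ut, 'a Ut) mpair \<Rightarrow>\<^sub>0 'a fps)"
    proof
      assume "Utensor_eq 0 (1 :: ('a Ut, 'a Ut) mpair \<Rightarrow>\<^sub>0 'a fps)"
      then have "1 \<in> tensor_null (Ut_scalar :: 'a fps \<Rightarrow> _) Ut_scalar"
        unfolding Utensor_eq_def by (drule_tac Utensor_null_uminus) simp
      from pair_counit_null[OF this] show False by (simp add: pair_counit_one)
    qed
  qed
qed (transfer; simp add: Utensor_eq_def algebra_simps Utensor_null_zero)+
end

lift_definition Utensor_scalar :: "'k::field fps \<Rightarrow> 'k Utensor" is "single 0" .

definition Utensor_pure :: "'k::field Ut \<Rightarrow> 'k Ut \<Rightarrow> 'k Utensor" where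
  "Utensor_pure a b = abs_Utensor (single (MPair a b) 1)"

text \<open>The value does not depend on the representative when \<open>f\<close> and \<open>g\<close> are \<open>\<bbbF>[[t]]\<close>-linear.\<close>

definition Utensor_map ::
  "('k::field Ut \<Rightarrow> 'k Ut) \<Rightarrow> ('k Ut \<Rightarrow> 'k Ut) \<Rightarrow> 'k Utensor \<Rightarrow> 'k Utensor" where
  "Utensor_map f g = map_fun rep_Utensor abs_Utensor (pm_push (map_mpair f g))"

abbreviation Utensor_t :: "'k::field Utensor" where "Utensor_t \<equiv> Utensor_scalar fps_X"

lift_definition Utensor_counit :: "'k::field Utensor \<Rightarrow> 'k fps" is pair_counit
  by (auto simp: Utensor_eq_def pair_counit_def pm_eval_diff dest!: pair_counit_null)

lemma Utensor_counit_diff: "Utensor_counit (x - y) = Utensor_counit x - Utensor_counit y"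
  by transfer (simp add: pair_counit_def pm_eval_diff)

lemma Utensor_counit_one [simp]: "Utensor_counit 1 = 1"
  by transfer (rule pair_counit_one)

lemma Utensor_counit_zero [simp]: "Utensor_counit 0 = 0"
  by transfer (simp add: pair_counit_def)

lemma Utensor_counit_scalar: "Utensor_counit (Utensor_scalar c * x) = c * Utensor_counit x"
  by transfer (simp add: pair_counit_def pm_eval_scale)

lemma Utensor_scalar_commute: "x * Utensor_scalar c = Utensor_scalar c * x"
  by transfer (simp add: single_0_commute Utensor_eq_def Utensor_null_zero)


section \<open>The \<open>t\<close>-adic completion\<close>

definition adic_close :: "'r::ring_1 \<Rightarrow> nat \<Rightarrow> 'r \<Rightarrow> 'r \<Rightarrow> bool" where
  "adic_close t n x y \<longleftrightarrow> (\<exists>z. x - y = t ^ n * z)"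

definition adic_cauchy :: "'r::ring_1 \<Rightarrow> (nat \<Rightarrow> 'r) \<Rightarrow> bool" where
  "adic_cauchy t s \<longleftrightarrow> (\<forall>n. \<exists>N. \<forall>i\<ge>N. \<forall>j\<ge>N. adic_close t n (s i) (s j))"

definition adic_equiv :: "'r::ring_1 \<Rightarrow> (nat \<Rightarrow> 'r) \<Rightarrow> (nat \<Rightarrow> 'r) \<Rightarrow> bool" where
  "adic_equiv t r s \<longleftrightarrow> (\<forall>n. \<exists>N. \<forall>i\<ge>N. adic_close t n (r i) (s i))"

lemma adic_close_refl: "adic_close t n x x"
  by (auto simp: adic_close_def intro: exI[of _ 0])

lemma adic_close_uminus: "adic_close t n x y \<Longrightarrow> adic_close t n (- x) (- y)"
  unfolding adic_close_def by (metis minus_diff_minus mult_minus_right)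

lemma adic_close_sym: "adic_close t n x y \<Longrightarrow> adic_close t n y x"
  unfolding adic_close_def by (metis minus_diff_eq mult_minus_right)

lemma adic_close_add:
  assumes "adic_close t n x y" "adic_close t n x' y'"
  shows "adic_close t n (x + x') (y + y')"
proof -
  obtain z z' where "x - y = t ^ n * z" "x' - y' = t ^ n * z'"
    using assms by (auto simp: adic_close_def)
  then have "(x + x') - (y + y') = t ^ n * (z + z')"
    by (simp add: distrib_left) (simp add: algebra_simps)
  then show ?thesis by (auto simp: adic_close_def)
qed

lemma adic_close_diff:
  "adic_close t n x y \<Longrightarrow> adic_close t n x' y' \<Longrightarrow> adic_close t n (x - x') (y - y')"
  using adic_close_add[of t n x y "- x'" "- y'"] adic_close_uminus by auto

lemma adic_close_trans:
  assumes "adic_close t n x y" "adic_close t n y z"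
  shows "adic_close t n x z"
  using adic_close_add[OF assms] by (simp add: adic_close_def algebra_simps)

lemma adic_close_mult_right: "adic_close t n x y \<Longrightarrow> adic_close t n (x * a) (y * a)"
  unfolding adic_close_def by (metis left_diff_distrib mult.assoc)

lemma adic_close_mult_left:
  assumes "\<And>x. x * t = t * x" "adic_close t n x y"
  shows "adic_close t n (a * x) (a * y)"
proof -
  have c: "a * t ^ n = t ^ n * a"
    by (rule power_commuting_commutes[symmetric]) (rule assms(1)[symmetric])
  obtain z where "x - y = t ^ n * z" using assms(2) by (auto simp: adic_close_def)
  then have "a * x - a * y = t ^ n * (a * z)"
    by (simp add: right_diff_distrib[symmetric] mult.assoc[symmetric] c)
  then show ?thesis by (auto simp: adic_close_def)
qed

lemma adic_close_mult:
  assumes "\<And>x. x * t = t * x" "adic_close t n x y" "adic_close t n x' y'"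
  shows "adic_close t n (x * x') (y * y')"
  using adic_close_mult_right[OF assms(2)] adic_close_mult_left[OF assms(1,3)]
  by (rule adic_close_trans)

lemma adic_close_mono:
  assumes "adic_close t n x y" "m \<le> n"
  shows "adic_close t m x y"
proof -
  have "t ^ n = t ^ m * t ^ (n - m)" using assms(2) by (simp add: power_add[symmetric])
  with assms(1) show ?thesis unfolding adic_close_def by (metis mult.assoc)
qed

lemma adic_cauchy_binop:
  assumes f: "\<And>n x y x' y'. adic_close t n x y \<Longrightarrow> adic_close t n x' y' \<Longrightarrow>
      adic_close t n (f x x') (f y y')"
    and "adic_cauchy t r" "adic_cauchy t s"
  shows "adic_cauchy t (\<lambda>i. f (r i) (s i))"
  unfolding adic_cauchy_def
proof
  fix n
  obtain M N where
    "\<forall>i\<ge>M. \<forall>j\<ge>M. adic_close t n (r i) (r j)" "\<forall>i\<ge>N. \<forall>j\<ge>N. adic_close t n (s i) (s j)"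
    using assms(2,3) unfolding adic_cauchy_def by meson
  then show "\<exists>N. \<forall>i\<ge>N. \<forall>j\<ge>N. adic_close t n (f (r i) (s i)) (f (r j) (s j))"
    by (intro exI[of _ "max M N"]) (simp add: f)
qed

lemma adic_cauchy_add:
  "adic_cauchy t r \<Longrightarrow> adic_cauchy t s \<Longrightarrow> adic_cauchy t (\<lambda>i. r i + s i)"
  by (rule adic_cauchy_binop) (rule adic_close_add)

lemma adic_cauchy_diff:
  "adic_cauchy t r \<Longrightarrow> adic_cauchy t s \<Longrightarrow> adic_cauchy t (\<lambda>i. r i - s i)"
  by (rule adic_cauchy_binop) (rule adic_close_diff)

lemma adic_cauchy_mult:
  "(\<And>x. x * t = t * x) \<Longrightarrow> adic_cauchy t r \<Longrightarrow> adic_cauchy t s \<Longrightarrow>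
    adic_cauchy t (\<lambda>i. r i * s i)"
  by (rule adic_cauchy_binop) (rule adic_close_mult)

lemma adic_equiv_binop:
  assumes f: "\<And>n x y x' y'. adic_close t n x y \<Longrightarrow> adic_close t n x' y' \<Longrightarrow>
      adic_close t n (f x x') (f y y')"
    and "adic_equiv t r r'" "adic_equiv t s s'"
  shows "adic_equiv t (\<lambda>i. f (r i) (s i)) (\<lambda>i. f (r' i) (s' i))"
  unfolding adic_equiv_def
proof
  fix n
  obtain M N where
    "\<forall>i\<ge>M. adic_close t n (r i) (r' i)" "\<forall>i\<ge>N. adic_close t n (s i) (s' i)"
    using assms(2,3) unfolding adic_equiv_def by meson
  then show "\<exists>N. \<forall>i\<ge>N. adic_close t n (f (r i) (s i)) (f (r' i) (s' i))"
    by (intro exI[of _ "max M N"]) (simp add: f)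
qed

lemma adic_cauchy_const: "adic_cauchy t (\<lambda>_. x)"
  by (simp add: adic_cauchy_def adic_close_refl)

lemma adic_equiv_refl: "adic_equiv t r r"
  by (simp add: adic_equiv_def adic_close_refl)

lemma adic_equiv_sym: "adic_equiv t r s \<Longrightarrow> adic_equiv t s r"
  unfolding adic_equiv_def using adic_close_sym by blast

lemma adic_equiv_trans:
  assumes "adic_equiv t r s" "adic_equiv t s u"
  shows "adic_equiv t r u"
  unfolding adic_equiv_def
proof
  fix n
  obtain M N where
    "\<forall>i\<ge>M. adic_close t n (r i) (s i)" "\<forall>i\<ge>N. adic_close t n (s i) (u i)"
    using assms unfolding adic_equiv_def by meson
  then show "\<exists>N. \<forall>i\<ge>N. adic_close t n (r i) (u i)"
    by (intro exI[of _ "max M N"]) (auto intro: adic_close_trans)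
qed

definition Uctensor_eq :: "(nat \<Rightarrow> 'k::field Utensor) \<Rightarrow> (nat \<Rightarrow> 'k Utensor) \<Rightarrow> bool" where
  "Uctensor_eq r s \<longleftrightarrow>
     adic_cauchy Utensor_t r \<and> adic_cauchy Utensor_t s \<and> adic_equiv Utensor_t r s"

lemma Uctensor_eq_part_equivp: "part_equivp (Uctensor_eq :: (nat \<Rightarrow> 'k::field Utensor) \<Rightarrow> _)"
proof (rule part_equivpI)
  show "\<exists>s :: nat \<Rightarrow> 'k Utensor. Uctensor_eq s s"
    by (auto simp: Uctensor_eq_def adic_equiv_refl intro!: exI[of _ "\<lambda>_. 0"] adic_cauchy_const)
  show "symp (Uctensor_eq :: (nat \<Rightarrow> 'k Utensor) \<Rightarrow> _)"
    by (auto simp: symp_def Uctensor_eq_def adic_equiv_sym)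
  show "transp (Uctensor_eq :: (nat \<Rightarrow> 'k Utensor) \<Rightarrow> _)"
    unfolding transp_def Uctensor_eq_def by (blast intro: adic_equiv_trans)
qed

text \<open>\<open>U(B(2))[[t]] \<otimes> U(B(2))[[t]]\<close>, completed: \<open>t\<close>-adic Cauchy sequences modulo null sequences.\<close>

quotient_type (overloaded) 'k Uctensor = "nat \<Rightarrow> 'k::field Utensor" / partial: Uctensor_eq
  by (rule Uctensor_eq_part_equivp)

lemma Uctensor_eq_binop:
  fixes f :: "'k::field Utensor \<Rightarrow> 'k Utensor \<Rightarrow> 'k Utensor"
  assumes "\<And>n x y x' y'. adic_close Utensor_t n x y \<Longrightarrow> adic_close Utensor_t n x' y' \<Longrightarrow>
      adic_close Utensor_t n (f x x') (f y y')"
    and "Uctensor_eq r r'" "Uctensor_eq s s'"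
  shows "Uctensor_eq (\<lambda>i. f (r i) (s i)) (\<lambda>i. f (r' i) (s' i))"
  using assms(2,3) adic_cauchy_binop[of Utensor_t f, OF assms(1)]
    adic_equiv_binop[of Utensor_t f, OF assms(1)]
  by (simp add: Uctensor_eq_def)

lemma Uctensor_eq_const: "Uctensor_eq (\<lambda>_. x) (\<lambda>_. x)"
  by (simp add: Uctensor_eq_def adic_cauchy_const adic_equiv_refl)

lemma Utensor_t_power_counit: "Utensor_counit (Utensor_t ^ n * x) = fps_X ^ n * Utensor_counit x"
  by (induction n) (simp_all add: mult.assoc Utensor_counit_scalar)

lemma Uctensor_zero_neq_one: "\<not> Uctensor_eq (\<lambda>_. 0) (\<lambda>_. 1 :: 'k::field Utensor)"
proof
  assume "Uctensor_eq (\<lambda>_. 0) (\<lambda>_. 1 :: 'k Utensor)"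
  then have "adic_close Utensor_t 1 (0 :: 'k Utensor) 1"
    unfolding Uctensor_eq_def adic_equiv_def by blast
  then obtain z where "(0 :: 'k Utensor) - 1 = Utensor_t ^ 1 * z"
    by (auto simp: adic_close_def)
  then have "Utensor_counit ((0 :: 'k Utensor) - 1) = Utensor_counit (Utensor_t ^ 1 * z)"
    by (rule arg_cong)
  then have "- 1 = fps_X * Utensor_counit z"
    by (simp only: Utensor_t_power_counit Utensor_counit_diff Utensor_counit_one
        Utensor_counit_zero) simp
  then have "fps_nth (- 1 :: 'k fps) 0 = fps_nth (fps_X * Utensor_counit z) 0"
    by (rule arg_cong)
  then show False by simp
qed

instantiation Uctensor :: (field) ring_1
begin
lift_definition zero_Uctensor :: "'a Uctensor" is "\<lambda>_. 0" by (rule Uctensor_eq_const)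
lift_definition one_Uctensor :: "'a Uctensor" is "\<lambda>_. 1" by (rule Uctensor_eq_const)
lift_definition plus_Uctensor :: "'a Uctensor \<Rightarrow> 'a Uctensor \<Rightarrow> 'a Uctensor"
  is "\<lambda>r s i. r i + s i"
  by (rule Uctensor_eq_binop) (auto intro: adic_close_add)
lift_definition uminus_Uctensor :: "'a Uctensor \<Rightarrow> 'a Uctensor" is "\<lambda>r i. - r i"
  by (rule Uctensor_eq_binop[where f = "\<lambda>x y. - x"]) (auto intro: adic_close_uminus)
lift_definition minus_Uctensor :: "'a Uctensor \<Rightarrow> 'a Uctensor \<Rightarrow> 'a Uctensor"
  is "\<lambda>r s i. r i - s i"
  by (rule Uctensor_eq_binop) (auto intro: adic_close_diff)
lift_definition times_Uctensor :: "'a Uctensor \<Rightarrow> 'a Uctensor \<Rightarrow> 'a Uctensor"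
  is "\<lambda>r s i. r i * s i"
  by (rule Uctensor_eq_binop) (auto intro: adic_close_mult Utensor_scalar_commute)
instance
proof
  fix a b c :: "'a Uctensor"
  show "(0 :: 'a Uctensor) \<noteq> 1" by transfer (rule Uctensor_zero_neq_one)
  show "a * b * c = a * (b * c)"
    by transfer (simp add: Uctensor_eq_def adic_cauchy_mult
        Utensor_scalar_commute mult.assoc adic_equiv_refl)
  show "a + b + c = a + (b + c)"
    by transfer (simp add: Uctensor_eq_def adic_cauchy_add
        add.assoc adic_equiv_refl)
  show "a + b = b + a"
    by transfer (simp add: Uctensor_eq_def adic_cauchy_add
        add.commute adic_equiv_refl)
  show "0 + a = a" by transfer (simp add: Uctensor_eq_def adic_equiv_refl)
  show "1 * a = a" by transfer (simp add: Uctensor_eq_def adic_equiv_refl)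
  show "a * 1 = a" by transfer (simp add: Uctensor_eq_def adic_equiv_refl)
  show "- a + a = 0"
    by transfer (simp add: Uctensor_eq_def adic_equiv_refl adic_cauchy_const)
  show "a - b = a + - b"
    by transfer (simp add: Uctensor_eq_def adic_cauchy_diff adic_equiv_refl)
  show "(a + b) * c = a * c + b * c"
    by transfer (simp add: Uctensor_eq_def adic_cauchy_mult adic_cauchy_add
        Utensor_scalar_commute distrib_right[symmetric] adic_equiv_refl)
  show "a * (b + c) = a * b + a * c"
    by transfer (simp add: Uctensor_eq_def adic_cauchy_mult adic_cauchy_add
        Utensor_scalar_commute distrib_left[symmetric] adic_equiv_refl)
qed
end

definition Uctensor_of :: "'k::field Utensor \<Rightarrow> 'k Uctensor" where
  "Uctensor_of x = abs_Uctensor (\<lambda>_. x)"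

definition Uctensor_scalar :: "'k::field \<Rightarrow> 'k Uctensor" where
  "Uctensor_scalar c = Uctensor_of (Utensor_scalar (fps_const c))"

definition Uctensor_pure :: "'k::field Ut \<Rightarrow> 'k Ut \<Rightarrow> 'k Uctensor" (infixl \<open>\<otimes>\<close> 75) where
  "a \<otimes> b = Uctensor_of (Utensor_pure a b)"

definition Uctensor_t :: "'k::field Uctensor" where
  "Uctensor_t = Uctensor_of Utensor_t"

text \<open>Again independent of representatives when \<open>f\<close> and \<open>g\<close> are \<open>\<bbbF>[[t]]\<close>-linear.\<close>

definition Uctensor_map ::
  "('k::field Ut \<Rightarrow> 'k Ut) \<Rightarrow> ('k Ut \<Rightarrow> 'k Ut) \<Rightarrow> 'k Uctensor \<Rightarrow> 'k Uctensor" where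
  "Uctensor_map f g = map_fun rep_Uctensor abs_Uctensor (\<lambda>s i. Utensor_map f g (s i))"

text \<open>The \<open>t\<close>-adic topology; on \<open>U(B(2))[[t]]\<close> the library's metric on \<open>fps\<close> is the \<open>t\<close>-adic one.\<close>

instantiation Uctensor :: (field) topological_space
begin
definition open_Uctensor :: "'a Uctensor set \<Rightarrow> bool" where
  "open_Uctensor S \<longleftrightarrow> (\<forall>x\<in>S. \<exists>n. \<forall>y. adic_close Uctensor_t n y x \<longrightarrow> y \<in> S)"
instance
proof
  show "open (UNIV :: 'a Uctensor set)" by (simp add: open_Uctensor_def)
next
  fix S T :: "'a Uctensor set"
  assume *: "open S" "open T"
  show "open (S \<inter> T)"
    unfolding open_Uctensor_def
  proof
    fix x assume "x \<in> S \<inter> T"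
    with * obtain m n where
      "\<forall>y. adic_close Uctensor_t m y x \<longrightarrow> y \<in> S" "\<forall>y. adic_close Uctensor_t n y x \<longrightarrow> y \<in> T"
      unfolding open_Uctensor_def by (meson IntE)
    then show "\<exists>n. \<forall>y. adic_close Uctensor_t n y x \<longrightarrow> y \<in> S \<inter> T"
      by (intro exI[of _ "max m n"]) (meson IntI adic_close_mono max.cobounded1 max.cobounded2)
  qed
next
  fix K :: "'a Uctensor set set"
  assume "\<forall>S\<in>K. open S"
  then show "open (\<Union> K)" unfolding open_Uctensor_def by (meson Union_iff)
qed
end

lemma Uctensor_t_power: "Uctensor_t ^ n = Uctensor_of (Utensor_t ^ n)"
  by (induction n)
    (simp_all add: Uctensor_t_def Uctensor_of_def one_Uctensor.abs_eq times_Uctensor.abs_eq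
      one_Uctensor_def Uctensor_eq_const)

lemma Uctensor_separated:
  assumes close: "\<And>n. adic_close Uctensor_t n x y"
  shows "x = y"
proof -
  note q = Quotient3_Uctensor
  define r s where "r = rep_Uctensor x" and "s = rep_Uctensor y"
  have x: "x = abs_Uctensor r" "Uctensor_eq r r" and y: "y = abs_Uctensor s" "Uctensor_eq s s"
    by (simp_all add: r_def s_def Quotient3_abs_rep[OF q] Quotient3_rep_reflp[OF q])
  have "\<exists>N. \<forall>i\<ge>N. adic_close Utensor_t n (r i) (s i)" for n
  proof -
    obtain w where w: "x - y = Uctensor_of (Utensor_t ^ n) * w"
      using close[of n] by (auto simp: adic_close_def Uctensor_t_power)
    define z where "z = rep_Uctensor w"
    have z: "w = abs_Uctensor z" "Uctensor_eq z z"
      by (simp_all add: z_def Quotient3_abs_rep[OF q] Quotient3_rep_reflp[OF q])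
    have "abs_Uctensor (\<lambda>i. r i - s i) = abs_Uctensor (\<lambda>i. Utensor_t ^ n * z i)"
      using w x y z
      by (simp add: Uctensor_of_def minus_Uctensor.abs_eq times_Uctensor.abs_eq
          Uctensor_eq_const)
    moreover have "Uctensor_eq (\<lambda>i. r i - s i) (\<lambda>i. r i - s i)"
      by (rule Uctensor_eq_binop[OF _ x(2) y(2)]) (rule adic_close_diff)
    moreover have "Uctensor_eq (\<lambda>i. Utensor_t ^ n * z i) (\<lambda>i. Utensor_t ^ n * z i)"
      by (rule Uctensor_eq_binop[OF _ Uctensor_eq_const z(2)])
        (rule adic_close_mult[OF Utensor_scalar_commute])
    ultimately have "Uctensor_eq (\<lambda>i. r i - s i) (\<lambda>i. Utensor_t ^ n * z i)"
      using Quotient3_rel[OF q] by blast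
    then have "adic_equiv Utensor_t (\<lambda>i. r i - s i) (\<lambda>i. Utensor_t ^ n * z i)"
      by (simp add: Uctensor_eq_def)
    then obtain N where "\<forall>i\<ge>N. adic_close Utensor_t n (r i - s i) (Utensor_t ^ n * z i)"
      unfolding adic_equiv_def by blast
    moreover have "adic_close Utensor_t n (Utensor_t ^ n * z i) 0" for i
      by (auto simp: adic_close_def)
    ultimately have "\<forall>i\<ge>N. adic_close Utensor_t n (r i - s i) 0"
      using adic_close_trans by blast
    then show ?thesis by (auto simp: adic_close_def)
  qed
  with x y have "Uctensor_eq r s" by (simp add: Uctensor_eq_def adic_equiv_def)
  with x y show ?thesis using Quotient3_rel[OF q] by blast
qed

instance Uctensor :: (field) t2_space
proof
  fix x y :: "'a Uctensor"
  assume "x \<noteq> y"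
  then obtain n where n: "\<not> adic_close Uctensor_t n x y" using Uctensor_separated by blast
  have ball: "open {y. adic_close Uctensor_t n y x}" for x :: "'a Uctensor"
    unfolding open_Uctensor_def by (auto intro!: exI[of _ n] intro: adic_close_trans)
  have "{z. adic_close Uctensor_t n z x} \<inter> {z. adic_close Uctensor_t n z y} = {}"
    using n by (auto dest: adic_close_sym adic_close_trans)
  then show "\<exists>U V. open U \<and> open V \<and> x \<in> U \<and> y \<in> V \<and> U \<inter> V = {}"
    using ball by (intro exI[of _ "{z. adic_close Uctensor_t n z x}"]
        exI[of _ "{z. adic_close Uctensor_t n z y}"]) (auto simp: adic_close_refl)
qed


section \<open>Formal series and the Jordanian twist\<close>

text \<open>
  Formal series evaluated in a topological algebra over \<open>\<bbbF>\<close> whose structure map is \<open>\<eta>\<close>.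
\<close>

definition formal_exp ::
  "('k::field_char_0 \<Rightarrow> 'a) \<Rightarrow> 'a \<Rightarrow> 'a::{ring_1, topological_space}" where
  "formal_exp \<eta> x = suminf (\<lambda>i. \<eta> (1 / fact i) * x ^ i)"

definition formal_ln1p ::
  "('k::field_char_0 \<Rightarrow> 'a) \<Rightarrow> 'a \<Rightarrow> 'a::{ring_1, topological_space}" where
  "formal_ln1p \<eta> x = suminf (\<lambda>i. \<eta> ((- 1) ^ (Suc i + 1) / of_nat (Suc i)) * x ^ Suc i)"

text \<open>
  A divergent \<open>suminf\<close> is an arbitrary value; the following predicates say that the
  defining series really converge.
\<close>

definition formal_exp_converges ::
  "('k::field_char_0 \<Rightarrow> 'a) \<Rightarrow> 'a::{ring_1, topological_space} \<Rightarrow> bool" where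
  "formal_exp_converges \<eta> x \<longleftrightarrow> summable (\<lambda>i. \<eta> (1 / fact i) * x ^ i)"

definition formal_ln1p_converges ::
  "('k::field_char_0 \<Rightarrow> 'a) \<Rightarrow> 'a::{ring_1, topological_space} \<Rightarrow> bool" where
  "formal_ln1p_converges \<eta> x \<longleftrightarrow>
     summable (\<lambda>i. \<eta> ((- 1) ^ (Suc i + 1) / of_nat (Suc i)) * x ^ Suc i)"

primrec falling :: "'a::ring_1 \<Rightarrow> nat \<Rightarrow> 'a" where
  "falling x 0 = 1"
| "falling x (Suc r) = falling x r * (x - of_nat r)"

primrec rising :: "'a::ring_1 \<Rightarrow> nat \<Rightarrow> 'a" where
  "rising x 0 = 1"
| "rising x (Suc r) = rising x r * (x + of_nat r)"

definition Ut_H :: "'k::field Ut" where "Ut_H = fps_const UB2_H"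
definition Ut_E :: "'k::field Ut" where "Ut_E = fps_const UB2_E"
abbreviation Ut_t :: "'k::field Ut" where "Ut_t \<equiv> fps_X"

abbreviation Ut_scalar0 :: "'k::field \<Rightarrow> 'k Ut" where
  "Ut_scalar0 c \<equiv> Ut_scalar (fps_const c)"

definition canonical_jordanian_twist :: "'k::field_char_0 Uctensor" where
  "canonical_jordanian_twist =
     formal_exp Uctensor_scalar (Ut_H \<otimes> formal_ln1p Ut_scalar0 (Ut_E * Ut_t))"

definition jordanian_twist :: "'k::field_char_0 Uctensor" where
  "jordanian_twist =
     suminf (\<lambda>r. Uctensor_scalar ((- 1) ^ r / fact r) * (falling Ut_H r \<otimes> (Ut_E ^ r * Ut_t ^ r)))"

end

(*
Everything takes place in the commutative subalgebra of series sum_r p_r(H) (x) E^r t^r with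
polynomials p_r over the ground field. There exp(H (x) ln(1 + E t)) is the image of the formal
series exp(x ln(1 + T)), and comparing coefficients reduces the first formula to polynomial
identities in x, which may be checked at every scalar x = c, where they express
exp(c ln(1 + T)) = (1 + T)^c. The inverse comes in the same way from (1 + T)^c (1 + T)^(-c) = 1,
and replacing E by -E gives the remaining claims.
*)
theory Submission
  imports Defs "HOL-Computational_Algebra.Polynomial"
begin

section \<open>Binomial polynomials\<close>

text \<open>The subalgebra is commutative because H stays in the left tensor factor and E in the
  right one. Coefficients are compared before evaluation, among polynomials over the field; the
  resulting identities are then pushed forward along x -> H, a direction that is valid whatever
  relations hold in the tensor product. The element put in place of E is an arbitrary
  \<open>e\<close> in U(B(2)) throughout: \<open>e = UB2_E\<close> gives the canonical twist,
  \<open>e = - UB2_E\<close> gives \<open>jordanian_twist\<close>, and an endomorphism of B(2)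
  fixing H acts on such series by changing \<open>e\<close> alone.\<close>

definition binom_poly :: "nat \<Rightarrow> 'k::field_char_0 poly" where
  "binom_poly r = smult (1 / fact r) (falling [:0, 1:] r)"

definition neg_binom_poly :: "nat \<Rightarrow> 'k::field_char_0 poly" where
  "neg_binom_poly r = smult ((- 1) ^ r / fact r) (rising [:0, 1:] r)"

lemma gbinomial_Suc_falling: "a gchoose Suc r = (a gchoose r) * (a - of_nat r) / of_nat (Suc r)"
  for a :: "'k::field_char_0"
  using gbinomial_mult_1[of a r] by (simp add: field_simps del: of_nat_Suc)

lemma falling_eq_gbinomial: "falling a r = fact r * (a gchoose r)"
  for a :: "'k::field_char_0"
  by (induction r) (simp_all add: gbinomial_Suc_falling field_simps del: of_nat_Suc)

lemma rising_eq_falling_minus: "rising a r = (- 1) ^ r * falling (- a) r"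
  for a :: "'a::comm_ring_1"
  by (induction r) (simp_all add: algebra_simps)

lemma poly_falling: "poly (falling p r) a = falling (poly p a) r"
  by (induction r) (simp_all)

lemma poly_rising: "poly (rising p r) a = rising (poly p a) r"
  by (induction r) (simp_all)

lemma poly_binom_poly: "poly (binom_poly r) a = a gchoose r"
  by (simp add: binom_poly_def poly_falling falling_eq_gbinomial)

lemma poly_neg_binom_poly: "poly (neg_binom_poly r) a = (- a) gchoose r"
  by (simp add: neg_binom_poly_def poly_rising)
    (simp add: rising_eq_falling_minus falling_eq_gbinomial mult.assoc[symmetric] flip: power_add)

text \<open>A field of characteristic 0 is infinite, so values determine a polynomial. This is the
  bridge from binomial series with scalar exponents to identities in an indeterminate.\<close>

lemma poly_ext: "p = q" if "\<And>a. poly p a = poly q a" for p q :: "'k::field_char_0 poly"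
  using that by (intro iffD1[OF poly_eq_poly_eq_iff] ext)

text \<open>Vandermonde's identity with exponents a and -a, at every scalar a.\<close>

lemma binom_poly_convolution:
  "(\<Sum>i\<le>r. binom_poly i * neg_binom_poly (r - i)) = (if r = 0 then 1 else 0 :: 'k::field_char_0 poly)"
proof -
  have "poly (\<Sum>i\<le>r. binom_poly i * neg_binom_poly (r - i)) a = poly (if r = 0 then 1 else 0) a"
    for a :: 'k
  proof -
    have "fps_nth (fps_binomial a * fps_binomial (- a)) r = (if r = 0 then 1 else 0)"
      by (simp flip: fps_binomial_add_mult)
    then show ?thesis
      by (simp add: poly_sum poly_binom_poly poly_neg_binom_poly fps_mult_nth atMost_atLeast0)
  qed
  then show ?thesis by (rule poly_ext)
qed

text \<open>Both sides solve (1 + T) y' = c y with y(0) = 1, and the solution is unique. The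
  argument 1 of \<open>fps_ln\<close> is a normalising divisor, so \<open>fps_ln 1\<close> is ln(1 +
  T) itself.\<close>

lemma fps_exp_compose_ln: "fps_exp c oo fps_ln 1 = fps_binomial (c :: 'k::field_char_0)"
proof -
  have "fps_deriv (fps_exp c oo fps_ln 1) = fps_const c * (fps_exp c oo fps_ln 1) / (1 + fps_X)"
    by (simp add: fps_compose_deriv fps_ln_deriv fps_compose_mult_distrib fps_divide_unit)
  then show ?thesis by (intro iffD1[OF fps_binomial_ODE_unique'] conjI) simp_all
qed

text \<open>Comes from the coefficient of T^r in exp(a ln(1 + T)) = (1 + T)^a, read as a polynomial
  in a. The numbers are s(r, i) / r! with s the signed Stirling numbers of the first kind.\<close>

lemma coeff_binom_poly: "coeff (binom_poly r) i = fps_nth (fps_ln 1 ^ i) r / fact i"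
proof -
  define q :: "'a poly" where
    "q = (\<Sum>i\<le>r. monom (fps_nth (fps_ln 1 ^ i) r / fact i) i)"
  have "poly (binom_poly r) a = poly q a" for a
    using arg_cong[OF fps_exp_compose_ln[of a], of "\<lambda>f. fps_nth f r"]
    by (simp add: poly_binom_poly q_def poly_sum poly_monom fps_compose_nth atMost_atLeast0
        mult.commute)
  then have "binom_poly r = q" by (rule poly_ext)
  \<comment> \<open>The polynomial \<open>q\<close> stops at degree r; beyond it the formula still
    holds, because ln(1 + T) has no constant term and its i-th power starts at T^i.\<close>
  moreover have "fps_nth (fps_ln 1 ^ i) r = (0::'a)" if "r < i"
    using that by (intro startsby_zero_power_prefix[rule_format]) simp_all
  ultimately show ?thesis by (auto simp: q_def coeff_sum not_le)
qed


section \<open>Evaluating polynomials in an algebra\<close>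

text \<open>Shared by the scalars of U(B(2)), of U(B(2))[[t]] (over the field and over the power
  series) and of the uncompleted tensor product. Centrality is what makes evaluation of polynomials
  multiplicative in a noncommutative target.\<close>

locale algebra_structure_map =
  fixes \<eta> :: "'k::comm_ring_1 \<Rightarrow> 'a::ring_1"
  assumes map_one: "\<eta> 1 = 1"
    and map_add: "\<eta> (a + b) = \<eta> a + \<eta> b"
    and map_mult: "\<eta> (a * b) = \<eta> a * \<eta> b"
    and central: "x * \<eta> a = \<eta> a * x"
begin

lemma left_central: "x * (\<eta> a * y) = \<eta> a * (x * y)"
  by (metis central mult.assoc)

lemma map_zero: "\<eta> 0 = 0"
  using map_add[of 0 0] by simp

lemma map_uminus: "\<eta> (- a) = - \<eta> a"
  using map_add[of a "- a"] by (simp add: map_zero eq_neg_iff_add_eq_0 add.commute)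

lemma map_power: "\<eta> (a ^ n) = \<eta> a ^ n"
  by (induction n) (simp_all add: map_one map_mult)

lemma map_sum: "\<eta> (sum f A) = (\<Sum>x\<in>A. \<eta> (f x))"
  by (induction A rule: infinite_finite_induct) (simp_all add: map_zero map_add)

text \<open>Horner evaluation at \<open>h\<close>, with coefficients and argument in different rings
  joined by the structure map.\<close>

definition poly_at :: "'a \<Rightarrow> 'k poly \<Rightarrow> 'a" where
  "poly_at h p = fold_coeffs (\<lambda>a y. \<eta> a + h * y) p 0"

lemma poly_at_0 [simp]: "poly_at h 0 = 0"
  by (simp add: poly_at_def)

lemma poly_at_pCons [simp]: "poly_at h (pCons a p) = \<eta> a + h * poly_at h p"
  by (cases "p = 0 \<and> a = 0") (auto simp: poly_at_def map_zero)

lemma poly_at_1 [simp]: "poly_at h 1 = 1"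
  by (simp add: one_pCons map_one)

lemma poly_at_add: "poly_at h (p + q) = poly_at h p + poly_at h q"
  by (induction p q rule: poly_induct2) (simp_all add: map_add distrib_left)

lemma poly_at_sum: "poly_at h (sum p A) = (\<Sum>i\<in>A. poly_at h (p i))"
  by (induction A rule: infinite_finite_induct) (simp_all add: poly_at_add)

lemma poly_at_smult: "poly_at h (smult c p) = \<eta> c * poly_at h p"
  by (induction p) (simp_all add: map_mult distrib_left left_central[of h])

lemma poly_at_mult: "poly_at h (p * q) = poly_at h p * poly_at h q"
  by (induction p)
    (simp_all add: poly_at_add poly_at_smult map_zero distrib_right mult.assoc)

lemma poly_at_uminus: "poly_at h (- p) = - poly_at h p"
  using poly_at_add[of h p "- p"] by (simp add: eq_neg_iff_add_eq_0 add.commute)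

lemma poly_at_diff: "poly_at h (p - q) = poly_at h p - poly_at h q"
  using poly_at_add[of h p "- q"] by (simp add: poly_at_uminus)

lemma poly_at_of_nat: "poly_at h (of_nat n) = of_nat n"
  by (induction n) (simp_all add: poly_at_add)

lemma poly_at_falling: "poly_at h (falling [:0, 1:] r) = falling h r"
  by (induction r) (simp_all add: poly_at_mult poly_at_diff poly_at_of_nat map_zero map_one)

lemma poly_at_rising: "poly_at h (rising [:0, 1:] r) = rising h r"
  by (induction r) (simp_all add: poly_at_mult poly_at_add poly_at_of_nat map_zero map_one)

lemma poly_at_monom: "poly_at h (monom c n) = \<eta> c * h ^ n"
  by (induction n) (simp_all add: monom_0 monom_Suc map_zero left_central[of h])

text \<open>The bound n only has to exceed the degree, so many polynomials can be expanded over one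
  common range of powers; the later interchange of sums relies on this.\<close>

lemma poly_at_altdef:
  assumes "\<And>i. n \<le> i \<Longrightarrow> coeff p i = 0"
  shows "poly_at h p = (\<Sum>i<n. \<eta> (coeff p i) * h ^ i)"
proof -
  have "p = (\<Sum>i<n. monom (coeff p i) i)"
    by (rule poly_eqI) (auto simp: coeff_sum assms not_less)
  then have "poly_at h p = poly_at h (\<Sum>i<n. monom (coeff p i) i)" by (rule arg_cong)
  then show ?thesis by (simp only: poly_at_sum poly_at_monom)
qed

end


section \<open>Structure maps and pure tensors\<close>

interpretation UB2: algebra_structure_map UB2_scalar
  by (unfold_locales; (rule UB2_scalar_commute)?; transfer)
    (simp_all add: UB2_eq_def single_add mult_single two_sided_ideal.zero)

interpretation Ut: algebra_structure_map Ut_scalar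
proof
  show "Ut_scalar 1 = 1" and "Ut_scalar (a + b) = Ut_scalar a + Ut_scalar b" for a b :: "'a fps"
    by (auto intro!: fps_ext simp: Ut_scalar_def UB2.map_zero UB2.map_one UB2.map_add)
  show "Ut_scalar (a * b) = Ut_scalar a * Ut_scalar b" for a b :: "'a fps"
    by (rule fps_ext) (simp add: Ut_scalar_def fps_mult_nth UB2.map_sum UB2.map_mult)
qed (rule Ut_scalar_commute)

interpretation Ut0: algebra_structure_map Ut_scalar0
  by (unfold_locales; (rule Ut_scalar_commute)?)
    (simp_all add: Ut.map_one flip: Ut.map_add Ut.map_mult)

interpretation Utensor: algebra_structure_map Utensor_scalar
  by (unfold_locales; (rule Utensor_scalar_commute)?; transfer)
    (simp_all add: Utensor_eq_def single_add mult_single Utensor_null_zero)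

lemma Ut_scalar_X: "Ut_scalar fps_X = fps_X"
  by (auto intro!: fps_ext simp: Ut_scalar_def fps_X_def UB2.map_zero UB2.map_one)

lemma Ut_scalar0_eq: "Ut_scalar0 c = fps_const (UB2_scalar c)"
  by (auto intro!: fps_ext simp: Ut_scalar_def UB2.map_zero)

lemma Utensor_eqI:
  "p - q \<in> tensor_relations Ut_scalar Ut_scalar \<Longrightarrow> abs_Utensor p = abs_Utensor q"
  unfolding Utensor.abs_eq_iff Utensor_eq_def tensor_null_def by (rule pm.span_base)

lemma Utensor_pure_add_left: "Utensor_pure (a + a') b = Utensor_pure a b + Utensor_pure a' b"
  unfolding Utensor_pure_def plus_Utensor.abs_eq
  by (rule Utensor_eqI) (simp only: tensor_relationsI diff_diff_eq[symmetric])

lemma Utensor_pure_add_right: "Utensor_pure a (b + b') = Utensor_pure a b + Utensor_pure a b'"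
  unfolding Utensor_pure_def plus_Utensor.abs_eq
  by (rule Utensor_eqI) (simp only: tensor_relationsI diff_diff_eq[symmetric])

lemma Utensor_scalar_times_pure_aux:
  "Utensor_scalar c * Utensor_pure a b = abs_Utensor (single (MPair a b) c)"
  by (simp add: Utensor_pure_def Utensor_scalar.abs_eq times_Utensor.abs_eq mult_single)

lemma Utensor_scalar_times_pure_left:
  "Utensor_scalar c * Utensor_pure a b = Utensor_pure (Ut_scalar c * a) b"
  unfolding Utensor_scalar_times_pure_aux unfolding Utensor_pure_def
  by (rule Utensor_eqI[symmetric]) (rule tensor_relationsI)

lemma Utensor_scalar_times_pure_right:
  "Utensor_scalar c * Utensor_pure a b = Utensor_pure a (Ut_scalar c * b)"
  unfolding Utensor_scalar_times_pure_aux unfolding Utensor_pure_def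
  by (rule Utensor_eqI[symmetric]) (rule tensor_relationsI)

lemma Utensor_pure_mult: "Utensor_pure a b * Utensor_pure c d = Utensor_pure (a * c) (b * d)"
  by (simp add: Utensor_pure_def times_Utensor.abs_eq mult_single)

lemma Utensor_pure_one: "Utensor_pure 1 1 = 1"
  by (simp add: Utensor_pure_def one_Utensor.abs_eq flip: zero_mpair_def single_one)

lemma Utensor_pure_power: "Utensor_pure a b ^ n = Utensor_pure (a ^ n) (b ^ n)"
  by (induction n) (simp_all add: Utensor_pure_one Utensor_pure_mult)

lemma Utensor_pure_zero_left [simp]: "Utensor_pure 0 b = 0"
  using Utensor_pure_add_left[of 0 0 b] by simp

lemma Utensor_pure_zero_right [simp]: "Utensor_pure a 0 = 0"
  using Utensor_pure_add_right[of a 0 0] by simp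

lemma Utensor_pure_sum_left: "Utensor_pure (sum f A) b = (\<Sum>x\<in>A. Utensor_pure (f x) b)"
  by (induction A rule: infinite_finite_induct) (simp_all add: Utensor_pure_add_left)

lemma Utensor_pure_sum_right: "Utensor_pure a (sum f A) = (\<Sum>x\<in>A. Utensor_pure a (f x))"
  by (induction A rule: infinite_finite_induct) (simp_all add: Utensor_pure_add_right)

text \<open>t is a scalar of the base ring of the tensor product, so it leaves the right factor.
  Order in t of a power series thereby becomes t-adic order of a tensor.\<close>

lemma Utensor_pure_X_power:
  "Utensor_pure a (fps_X ^ n * b) = Utensor_t ^ n * Utensor_pure a b"
  by (simp add: Utensor_scalar_times_pure_right Ut_scalar_X Ut.map_power flip: Utensor.map_power)

lemma adic_close_sum:
  "(\<And>x. x \<in> A \<Longrightarrow> adic_close t n (f x) (g x)) \<Longrightarrow> adic_close t n (sum f A) (sum g A)"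
  by (induction A rule: infinite_finite_induct) (auto simp: adic_close_refl adic_close_add)

lemma adic_close_Utensor_pure_right:
  assumes "adic_close fps_X n b b'"
  shows "adic_close Utensor_t n (Utensor_pure a b) (Utensor_pure a b')"
proof -
  obtain z where "b - b' = fps_X ^ n * z" using assms by (auto simp: adic_close_def)
  then have "b = b' + fps_X ^ n * z" by (simp add: algebra_simps)
  then show ?thesis by (auto simp: adic_close_def Utensor_pure_add_right Utensor_pure_X_power)
qed


section \<open>Series in the completed tensor product\<close>

text \<open>The remainder after \<open>n\<close> terms is \<open>t\<^sup>n\<close> times another series of the same shape. Hence
  completeness of the quotient is not needed: the class of the partial sums is the limit.\<close>

abbreviation t_partial_sum :: "(nat \<Rightarrow> 'k::field Utensor) \<Rightarrow> nat \<Rightarrow> 'k Utensor" where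
  "t_partial_sum a n \<equiv> \<Sum>r<n. Utensor_t ^ r * a r"

lemma t_partial_sum_diff:
  assumes "n \<le> m"
  shows "t_partial_sum a m - t_partial_sum a n = Utensor_t ^ n * t_partial_sum (\<lambda>r. a (n + r)) (m - n)"
  using assms
proof (induction m rule: dec_induct)
  case (step m)
  then have "Utensor_t ^ m * a m = Utensor_t ^ n * (Utensor_t ^ (m - n) * a m)"
    by (simp add: mult.assoc[symmetric] flip: power_add)
  with step show ?case by (simp add: Suc_diff_le algebra_simps)
qed simp

lemma adic_close_t_partial_sum:
  "n \<le> i \<Longrightarrow> n \<le> j \<Longrightarrow> adic_close Utensor_t n (t_partial_sum a i) (t_partial_sum a j)"
proof (induction i j rule: linorder_wlog)
  case (le i j)
  then have "adic_close Utensor_t i (t_partial_sum a j) (t_partial_sum a i)"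
    unfolding adic_close_def using t_partial_sum_diff by blast
  with le show ?case using adic_close_mono adic_close_sym by blast
qed (auto intro: adic_close_sym)

text \<open>The quotient is partial: being related to itself means being Cauchy, and only for such
  sequences does \<open>abs_Uctensor\<close> carry meaning.\<close>

lemma Uctensor_eq_t_partial_sum: "Uctensor_eq (t_partial_sum a) (t_partial_sum a)"
  unfolding Uctensor_eq_def adic_cauchy_def
  using adic_close_t_partial_sum adic_equiv_refl by blast

text \<open>A diagonal criterion: for i \<ge> n, congruence of the i-th entries modulo t^i implies
  congruence modulo t^n. An equality of limits thus becomes one congruence between finite sums for
  each n.\<close>

lemma Uctensor_eqI:
  assumes "Uctensor_eq r r" "Uctensor_eq s s"
    and "\<And>n. adic_close Utensor_t n (r n) (s n)"
  shows "abs_Uctensor r = abs_Uctensor s"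
proof -
  have "adic_equiv Utensor_t r s"
    unfolding adic_equiv_def using assms(3) adic_close_mono by blast
  with assms show ?thesis by (intro Quotient3_rel_abs[OF Quotient3_Uctensor]) (simp add: Uctensor_eq_def)
qed

lemma Uctensor_of_mult: "Uctensor_of (x * y) = Uctensor_of x * Uctensor_of y"
  by (simp add: Uctensor_of_def times_Uctensor.abs_eq Uctensor_eq_const)

lemma Uctensor_of_add: "Uctensor_of (x + y) = Uctensor_of x + Uctensor_of y"
  by (simp add: Uctensor_of_def plus_Uctensor.abs_eq Uctensor_eq_const)

lemma Uctensor_of_one: "Uctensor_of 1 = 1"
  by (simp add: Uctensor_of_def one_Uctensor_def)

lemma Uctensor_of_zero: "Uctensor_of 0 = 0"
  by (simp add: Uctensor_of_def zero_Uctensor_def)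

lemma Uctensor_of_sum: "Uctensor_of (sum f A) = (\<Sum>x\<in>A. Uctensor_of (f x))"
  by (induction A rule: infinite_finite_induct) (simp_all add: Uctensor_of_add Uctensor_of_zero)

lemma Uctensor_of_power: "Uctensor_of (x ^ n) = Uctensor_of x ^ n"
  by (induction n) (simp_all add: Uctensor_of_mult Uctensor_of_one)

lemma t_series_sums:
  "(\<lambda>r. Uctensor_of (Utensor_t ^ r * a r)) sums abs_Uctensor (t_partial_sum a)"
  unfolding sums_def
proof (rule topological_tendstoI)
  fix S assume "open S" "abs_Uctensor (t_partial_sum a) \<in> S"
  then obtain n where n: "\<And>y. adic_close Uctensor_t n y (abs_Uctensor (t_partial_sum a)) \<Longrightarrow> y \<in> S"
    unfolding open_Uctensor_def by blast
  have "adic_close Uctensor_t n (Uctensor_of (t_partial_sum a m)) (abs_Uctensor (t_partial_sum a))"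
    if "n \<le> m" for m
  proof -
    define b where "b = (\<lambda>r. a (m + r))"
    have "abs_Uctensor (\<lambda>i. t_partial_sum a i - t_partial_sum a m)
        = abs_Uctensor (\<lambda>i. Utensor_t ^ m * t_partial_sum b i)"
    proof (rule Uctensor_eqI)
      show "Uctensor_eq (\<lambda>i. t_partial_sum a i - t_partial_sum a m)
          (\<lambda>i. t_partial_sum a i - t_partial_sum a m)"
        by (rule Uctensor_eq_binop[OF _ Uctensor_eq_t_partial_sum Uctensor_eq_const])
          (rule adic_close_diff)
      show "Uctensor_eq (\<lambda>i. Utensor_t ^ m * t_partial_sum b i) (\<lambda>i. Utensor_t ^ m * t_partial_sum b i)"
        by (rule Uctensor_eq_binop[OF _ Uctensor_eq_const Uctensor_eq_t_partial_sum])
          (rule adic_close_mult[OF Utensor_scalar_commute])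
      fix i
      have "t_partial_sum a (m + i) - t_partial_sum a m = Utensor_t ^ m * t_partial_sum b i"
        using t_partial_sum_diff[of m "m + i" a] by (simp add: b_def)
      \<comment> \<open>The tail with i terms ends at index m + i, whereas the left sequence ends at
        i; the discrepancy is divisible by t^i, which the diagonal criterion allows.\<close>
      moreover have "adic_close Utensor_t i (t_partial_sum a i - t_partial_sum a m)
          (t_partial_sum a (m + i) - t_partial_sum a m)"
        by (intro adic_close_diff adic_close_refl adic_close_t_partial_sum) simp_all
      ultimately show "adic_close Utensor_t i (t_partial_sum a i - t_partial_sum a m)
          (Utensor_t ^ m * t_partial_sum b i)" by simp
    qed
    then have "abs_Uctensor (t_partial_sum a) - Uctensor_of (t_partial_sum a m)
        = Uctensor_t ^ m * abs_Uctensor (t_partial_sum b)"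
      unfolding Uctensor_t_power
      by (simp add: Uctensor_of_def minus_Uctensor.abs_eq times_Uctensor.abs_eq
          Uctensor_eq_const Uctensor_eq_t_partial_sum)
    then have "adic_close Uctensor_t m (abs_Uctensor (t_partial_sum a)) (Uctensor_of (t_partial_sum a m))"
      by (auto simp: adic_close_def)
    with that show ?thesis using adic_close_mono adic_close_sym by blast
  qed
  then show "\<forall>\<^sub>F m in sequentially. (\<Sum>r<m. Uctensor_of (Utensor_t ^ r * a r)) \<in> S"
    using n by (auto simp: eventually_sequentially simp flip: Uctensor_of_sum)
qed


section \<open>Scalar power series in \<open>e t\<close>\<close>

text \<open>The substitution T -> e t, given coefficientwise so that no limit is involved. It is
  multiplicative because only central scalars and powers of the single element \<open>e\<close>
  meet.\<close>

definition fps_at :: "'k::field UB2 \<Rightarrow> 'k fps \<Rightarrow> 'k Ut" where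
  "fps_at e f = Abs_fps (\<lambda>n. UB2_scalar (fps_nth f n) * e ^ n)"

lemma fps_at_one: "fps_at e 1 = 1"
  by (rule fps_ext) (simp add: fps_at_def UB2.map_zero UB2.map_one)

lemma fps_at_mult: "fps_at e (f * g) = fps_at e f * fps_at e g"
proof (rule fps_ext)
  fix n
  have "UB2_scalar (fps_nth f i * fps_nth g (n - i)) * e ^ n
      = UB2_scalar (fps_nth f i) * e ^ i * (UB2_scalar (fps_nth g (n - i)) * e ^ (n - i))"
    if "i \<le> n" for i
  proof -
    have "e ^ n = e ^ i * e ^ (n - i)" using that by (simp flip: power_add)
    then show ?thesis by (simp add: UB2.map_mult mult.assoc UB2.left_central[of "e ^ i"])
  qed
  then show "fps_nth (fps_at e (f * g)) n = fps_nth (fps_at e f * fps_at e g) n"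
    by (simp add: fps_at_def fps_mult_nth UB2.map_sum sum_distrib_right)
qed

lemma fps_at_power: "fps_at e (f ^ n) = fps_at e f ^ n"
  by (induction n) (simp_all add: fps_at_one fps_at_mult)

lemma fps_X_mult_power: "(fps_X * f) ^ n = fps_X ^ n * f ^ n" for f :: "'a::ring_1 fps"
proof (induction n)
  case (Suc n)
  have "f * fps_X ^ n = fps_X ^ n * f" by (rule fps_mult_fps_X_power_commute[symmetric])
  then have "f * (fps_X ^ n * f ^ n) = fps_X ^ n * (f * f ^ n)" by (metis mult.assoc)
  with Suc show ?case by (simp add: mult.assoc)
qed simp

lemma fps_const_times_X_power: "(fps_const e * fps_X) ^ n = fps_X ^ n * fps_const (e ^ n)"
  for e :: "'a::ring_1"
  unfolding fps_mult_fps_X_commute[of "fps_const e", symmetric] fps_X_mult_power by (simp add: fps_const_power)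

lemma fps_X_power_times_const_nth:
  "fps_nth (fps_X ^ r * fps_const c) n = (if n = r then c else 0)" for c :: "'a::ring_1"
  by (auto simp: fps_X_power_mult_nth)

lemma adic_close_fps_at:
  "adic_close fps_X n (fps_at e f)
    (\<Sum>r<n. Ut_scalar0 (fps_nth f r) * (fps_const e * fps_X) ^ r)"
proof -
  have "Ut_scalar0 (fps_nth f r) * (fps_const e * fps_X) ^ r
      = fps_X ^ r * fps_const (fps_nth (fps_at e f) r)" for r
    by (simp add: Ut_scalar0_eq fps_const_times_X_power fps_at_def
        fps_mult_fps_X_power_commute mult.assoc[symmetric])
  moreover have "fps_at e f - (\<Sum>r<n. fps_X ^ r * fps_const (fps_nth (fps_at e f) r))
      = fps_X ^ n * fps_shift n (fps_at e f)"
    by (rule fps_ext)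
      (simp add: fps_X_power_mult_nth, simp add: fps_sum_nth fps_X_power_times_const_nth
        del: fps_mult_right_const_nth)
  ultimately show ?thesis by (auto simp: adic_close_def)
qed

lemma ln1p_series_sums:
  fixes e :: "'k::field_char_0 UB2"
  shows "(\<lambda>i. Ut_scalar0 ((- 1) ^ (Suc i + 1) / of_nat (Suc i)) * (fps_const e * fps_X) ^ Suc i)
    sums fps_at e (fps_ln 1)"
  unfolding sums_def
proof (rule tendsto_fpsI)
  fix n
  have eq: "Ut_scalar0 c * (fps_const e * fps_X) ^ r = fps_X ^ r * fps_const (UB2_scalar c * e ^ r)"
    for r and c :: 'k
    by (simp add: Ut_scalar0_eq fps_const_times_X_power
        fps_mult_fps_X_power_commute mult.assoc[symmetric])
  \<comment> \<open>The m terms have orders 1 to m in t, so the coefficient at n is final as soon as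
    n \<le> m; at n = 0 both sides vanish.\<close>
  have "fps_nth (\<Sum>i<m. Ut_scalar0 ((- 1) ^ (Suc i + 1) / of_nat (Suc i)) *
      (fps_const e * fps_X) ^ Suc i) n = fps_nth (fps_at e (fps_ln 1)) n" if "n \<le> m" for m
    unfolding eq fps_sum_nth fps_X_power_times_const_nth using that
    by (cases n) (simp_all add: fps_at_def fps_ln_nth UB2.map_zero sum.delta' Suc_le_eq)
  then show "\<forall>\<^sub>F m in sequentially. fps_nth (\<Sum>i<m. Ut_scalar0 ((- 1) ^ (Suc i + 1) / of_nat (Suc i)) *
      (fps_const e * fps_X) ^ Suc i) n = fps_nth (fps_at e (fps_ln 1)) n"
    by (auto simp: eventually_sequentially)
qed

lemma formal_ln1p_eq:
  fixes e :: "'k::field_char_0 UB2"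
  shows "formal_ln1p Ut_scalar0 (fps_const e * fps_X) = fps_at e (fps_ln 1)"
    and "formal_ln1p_converges Ut_scalar0 (fps_const e * fps_X)"
  using ln1p_series_sums[of e]
  by (simp_all only: formal_ln1p_def formal_ln1p_converges_def sums_unique[symmetric] sums_summable)


section \<open>Tensor series with polynomial coefficients in \<open>H\<close>\<close>

text \<open>The factor t^r is left out here, since \<open>t_partial_sum\<close> supplies it.\<close>

definition poly_tensor :: "'k::field UB2 \<Rightarrow> (nat \<Rightarrow> 'k poly) \<Rightarrow> nat \<Rightarrow> 'k Utensor" where
  "poly_tensor e p r = Utensor_pure (Ut0.poly_at Ut_H (p r)) (fps_const (e ^ r))"

definition poly_series :: "'k::field UB2 \<Rightarrow> (nat \<Rightarrow> 'k poly) \<Rightarrow> 'k Uctensor" where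
  "poly_series e p = abs_Uctensor (t_partial_sum (poly_tensor e p))"

lemma t_power_poly_tensor:
  "Utensor_t ^ r * poly_tensor e p r
    = Utensor_pure (Ut0.poly_at Ut_H (p r)) ((fps_const e * fps_X) ^ r)"
  by (simp add: poly_tensor_def fps_const_times_X_power Utensor_pure_X_power)

lemma Uctensor_scalar_times_pure: "Uctensor_scalar c * (a \<otimes> b) = (Ut_scalar0 c * a) \<otimes> b"
  by (simp add: Uctensor_scalar_def Uctensor_pure_def Utensor_scalar_times_pure_left
      flip: Uctensor_of_mult)

lemma poly_series_sums:
  "(\<lambda>r. Ut0.poly_at Ut_H (p r) \<otimes> (fps_const e * fps_X) ^ r) sums poly_series e p"
  using t_series_sums[of "poly_tensor e p"]
  by (simp only: t_power_poly_tensor poly_series_def Uctensor_pure_def)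

lemma binom_poly_series_sums:
  "(\<lambda>r. Uctensor_scalar (1 / fact r) * (falling Ut_H r \<otimes> (fps_const e * fps_X) ^ r))
    sums poly_series e binom_poly"
  using poly_series_sums[of binom_poly e]
  by (simp add: binom_poly_def Ut0.poly_at_smult Ut0.poly_at_falling Uctensor_scalar_times_pure)

lemma neg_binom_poly_series_sums:
  "(\<lambda>r. Uctensor_scalar ((- 1) ^ r / fact r) * (rising Ut_H r \<otimes> (fps_const e * fps_X) ^ r))
    sums poly_series e neg_binom_poly"
  using poly_series_sums[of neg_binom_poly e]
  by (simp add: neg_binom_poly_def Ut0.poly_at_smult Ut0.poly_at_rising Uctensor_scalar_times_pure)

text \<open>Modulo \<open>t\<^sup>n\<close>, both sides are the double sum over \<open>i, r < n\<close> of
  \<open>[T\<^sup>r] (ln (1 + T))\<^sup>i / i! H\<^sup>i \<otimes> e\<^sup>r t\<^sup>r\<close>.\<close>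

lemma exp_ln_series_sums:
  fixes e :: "'k::field_char_0 UB2"
  shows "(\<lambda>i. Uctensor_scalar (1 / fact i) * (Ut_H \<otimes> fps_at e (fps_ln 1)) ^ i)
    sums poly_series e binom_poly"
proof -
  let ?x = "fps_const e * fps_X"
  define M where "M = fps_shift 1 (fps_at e (fps_ln 1 :: 'k fps))"
  \<comment> \<open>The missing constant term of ln(1 + T) yields a factor t, hence t^i in the i-th
    term of the exponential: this is why that series converges and fits the shape of
    \<open>t_partial_sum\<close>.\<close>
  have M: "fps_at e (fps_ln 1) = fps_X * M"
    unfolding M_def by (rule fps_ext) (simp add: fps_at_def UB2.map_zero)
  define h :: "nat \<Rightarrow> 'k Ut" where "h i = Ut_scalar0 (1 / fact i) * Ut_H ^ i" for i
  have hc: "h i * Ut_scalar0 c = Ut_scalar0 (c / fact i) * Ut_H ^ i" for i c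
    unfolding h_def Ut0.central[of _ c] mult.assoc[symmetric] Ut0.map_mult[symmetric] by simp
  define a where "a i = Utensor_pure (h i) (M ^ i)" for i
  have ta: "Utensor_t ^ i * a i = Utensor_pure (h i) (fps_at e (fps_ln 1 ^ i))" for i
    by (simp add: a_def fps_at_power M fps_X_mult_power Utensor_pure_X_power)
  have "Uctensor_scalar (1 / fact i) * (Ut_H \<otimes> fps_at e (fps_ln 1)) ^ i
      = Uctensor_of (Utensor_t ^ i * a i)" for i
    unfolding ta h_def fps_at_power
    by (simp add: Uctensor_scalar_def Uctensor_pure_def Utensor_pure_power
        Utensor_scalar_times_pure_left flip: Uctensor_of_power Uctensor_of_mult)
  moreover have "abs_Uctensor (t_partial_sum a) = poly_series e binom_poly"
    unfolding poly_series_def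
  proof (rule Uctensor_eqI)
    fix n
    \<comment> \<open>For r < n the degree in H is below n, so cutting the exponential at i < n
      loses nothing.\<close>
    have coeff: "Ut0.poly_at Ut_H (binom_poly r) = (\<Sum>i<n. h i * Ut_scalar0 (fps_nth (fps_ln 1 ^ i) r))"
      if "r < n" for r
    proof -
      have "coeff (binom_poly r :: 'k poly) i = 0" if "n \<le> i" for i
        using that \<open>r < n\<close> by (simp add: coeff_binom_poly startsby_zero_power_prefix)
      then show ?thesis
        by (subst Ut0.poly_at_altdef[of n])
          (simp_all add: coeff_binom_poly hc)
    qed
    have "adic_close Utensor_t n (t_partial_sum a n)
        (\<Sum>i<n. Utensor_pure (h i) (\<Sum>r<n. Ut_scalar0 (fps_nth (fps_ln 1 ^ i) r) * ?x ^ r))"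
      unfolding ta by (intro adic_close_sum adic_close_Utensor_pure_right adic_close_fps_at)
    \<comment> \<open>The field coefficients of the logarithm's powers cross the tensor sign, to be
      collected with the powers of H.\<close>
    also have "(\<Sum>i<n. Utensor_pure (h i) (\<Sum>r<n. Ut_scalar0 (fps_nth (fps_ln 1 ^ i) r) * ?x ^ r))
        = (\<Sum>i<n. \<Sum>r<n. Utensor_pure (h i * Ut_scalar0 (fps_nth (fps_ln 1 ^ i) r)) (?x ^ r))"
      by (simp only: Utensor_pure_sum_right Ut0.central[of "h _"]
          Utensor_scalar_times_pure_left[symmetric] Utensor_scalar_times_pure_right[symmetric])
    also have "\<dots> = (\<Sum>r<n. \<Sum>i<n. Utensor_pure (h i * Ut_scalar0 (fps_nth (fps_ln 1 ^ i) r)) (?x ^ r))"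
      by (rule sum.swap)
    also have "\<dots> = t_partial_sum (poly_tensor e binom_poly) n"
      by (simp add: t_power_poly_tensor coeff Utensor_pure_sum_left)
    finally show "adic_close Utensor_t n (t_partial_sum a n) (t_partial_sum (poly_tensor e binom_poly) n)" .
  qed (rule Uctensor_eq_t_partial_sum)+
  ultimately show ?thesis using t_series_sums[of a] by simp
qed

lemma formal_exp_ln1p:
  fixes e :: "'k::field_char_0 UB2"
  shows "formal_exp Uctensor_scalar (Ut_H \<otimes> formal_ln1p Ut_scalar0 (fps_const e * fps_X))
      = poly_series e binom_poly"
    and "formal_exp_converges Uctensor_scalar (Ut_H \<otimes> formal_ln1p Ut_scalar0 (fps_const e * fps_X))"
  using exp_ln_series_sums[of e]
  by (simp_all only: formal_ln1p_eq formal_exp_def formal_exp_converges_def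
      sums_unique[symmetric] sums_summable)

text \<open>A Cauchy product: the factors multiply separately, (p_i q_j)(H) \<otimes> (e t)^(i + j),
  so each power of t collects one convolution of polynomials.\<close>

lemma poly_series_one:
  assumes "\<And>r. (\<Sum>i\<le>r. p i * q (r - i)) = (if r = 0 then 1 else 0)"
  shows "poly_series e p * poly_series e q = 1"
proof -
  let ?h = "Ut0.poly_at Ut_H" and ?x = "fps_const e * fps_X"
  let ?P = "t_partial_sum (poly_tensor e p)" and ?Q = "t_partial_sum (poly_tensor e q)"
  have "poly_series e p * poly_series e q = abs_Uctensor (\<lambda>n. ?P n * ?Q n)"
    by (simp add: poly_series_def times_Uctensor.abs_eq Uctensor_eq_t_partial_sum)
  also have "\<dots> = abs_Uctensor (\<lambda>_. 1)"
  proof (rule Uctensor_eqI)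
    show "Uctensor_eq (\<lambda>n. ?P n * ?Q n) (\<lambda>n. ?P n * ?Q n)"
      by (rule Uctensor_eq_binop[OF _ Uctensor_eq_t_partial_sum Uctensor_eq_t_partial_sum])
        (rule adic_close_mult[OF Utensor_scalar_commute])
    fix n
    define g where "g i j = Utensor_pure (?h (p i * q j)) (?x ^ (i + j))" for i j
    have "?P n * ?Q n = (\<Sum>i<n. \<Sum>j<n. g i j)"
      by (simp add: t_power_poly_tensor sum_product Utensor_pure_mult Ut0.poly_at_mult g_def
          power_add)
    then have square: "?P n * ?Q n = (\<Sum>(i, j)\<in>{..<n} \<times> {..<n}. g i j)"
      by (simp add: sum.cartesian_product)
    \<comment> \<open>The product of truncations is a sum over a square; its part outside the
      triangle i + j < n is divisible by t^n.\<close>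
    have "adic_close Utensor_t n (g i j) (if i + j < n then g i j else 0)" for i j
    proof (cases "i + j < n")
      case False
      have "adic_close Utensor_t (i + j) (g i j) 0"
        unfolding g_def fps_const_times_X_power Utensor_pure_X_power adic_close_def by auto
      with False show ?thesis by (auto intro: adic_close_mono)
    qed (simp add: adic_close_refl)
    then have "adic_close Utensor_t n (\<Sum>(i, j)\<in>{..<n} \<times> {..<n}. g i j)
        (\<Sum>(i, j)\<in>{..<n} \<times> {..<n}. if i + j < n then g i j else 0)"
      by (intro adic_close_sum) auto
    also have "(\<Sum>(i, j)\<in>{..<n} \<times> {..<n}. if i + j < n then g i j else 0)
        = (\<Sum>(i, j)\<in>{(i, j). i + j < n}. g i j)"
      by (rule sum.mono_neutral_cong_right) (auto split: if_splits)
    also have "\<dots> = (\<Sum>r<n. \<Sum>i\<le>r. g i (r - i))"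
      by (rule sum.triangle_reindex)
    also have "\<dots> = (\<Sum>r<n. Utensor_pure (?h (\<Sum>i\<le>r. p i * q (r - i))) (?x ^ r))"
      by (simp add: g_def Utensor_pure_sum_left Ut0.poly_at_sum)
    also have "\<dots> = (\<Sum>r<n. if r = 0 then 1 else 0)"
      by (intro sum.cong) (simp_all add: assms Utensor_pure_one)
    finally have close: "adic_close Utensor_t n (?P n * ?Q n) (\<Sum>r<n. if r = 0 then 1 else 0)"
      unfolding square .
    \<comment> \<open>For n = 0 the sum is empty and not 1, but congruence modulo t^0 is always
      true.\<close>
    have "adic_close Utensor_t n (\<Sum>r<n. if r = 0 then 1 else 0) 1"
      by (cases n) (simp_all add: adic_close_refl, simp add: adic_close_def)
    with close show "adic_close Utensor_t n (?P n * ?Q n) 1"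
      by (rule adic_close_trans)
  qed (rule Uctensor_eq_const)
  finally show ?thesis by (simp add: one_Uctensor_def)
qed

lemma binom_poly_series_inverse:
  "poly_series e binom_poly * poly_series e neg_binom_poly = 1"
  "poly_series e neg_binom_poly * poly_series e binom_poly = 1"
proof -
  show "poly_series e binom_poly * poly_series e neg_binom_poly = 1"
    by (rule poly_series_one) (rule binom_poly_convolution)
  \<comment> \<open>The other side of the inverse: polynomials commute, so reversing the sum leads
    back to the same convolution.\<close>
  have "(\<Sum>i\<le>r. neg_binom_poly i * binom_poly (r - i))
      = (\<Sum>i\<le>r. binom_poly i * neg_binom_poly (r - i) :: 'a poly)" for r
    unfolding atMost_atLeast0 by (subst sum.atLeastAtMost_rev) (auto intro!: sum.cong simp: mult.commute)
  then show "poly_series e neg_binom_poly * poly_series e binom_poly = 1"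
    by (intro poly_series_one) (simp only: binom_poly_convolution)
qed


section \<open>Functoriality\<close>

lemma pm_push_superset:
  assumes "finite A" and "keys p \<subseteq> A"
  shows "pm_push f p = (\<Sum>x\<in>A. single (f x) (lookup p x))"
  unfolding pm_push_def using assms
  by (intro sum.mono_neutral_left) (auto simp: in_keys_iff)

lemma pm_push_single: "pm_push f (single x c) = single (f x) c"
  by (cases "c = 0") (simp_all add: pm_push_def)

lemma pm_push_add: "pm_push f (p + q) = pm_push f p + pm_push f q"
proof -
  let ?A = "keys p \<union> keys q"
  have "pm_push f (p + q) = (\<Sum>x\<in>?A. single (f x) (lookup (p + q) x))"
    by (rule pm_push_superset) (use keys_add[of p q] in auto)
  moreover have "pm_push f p = (\<Sum>x\<in>?A. single (f x) (lookup p x))"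
    by (rule pm_push_superset) auto
  moreover have "pm_push f q = (\<Sum>x\<in>?A. single (f x) (lookup q x))"
    by (rule pm_push_superset) auto
  ultimately show ?thesis
    by (simp add: lookup_add single_add sum.distrib)
qed

lemma pm_push_zero [simp]: "pm_push f 0 = 0"
  by (simp add: pm_push_def)

lemma pm_push_diff: "pm_push f (p - q) = pm_push f p - pm_push f q"
  for p q :: "'m \<Rightarrow>\<^sub>0 'c::ab_group_add"
  using pm_push_add[of f "p - q" q] by simp

lemma pm_push_sum: "pm_push f (sum g A) = (\<Sum>x\<in>A. pm_push f (g x))"
  by (induction A rule: infinite_finite_induct) (simp_all add: pm_push_add)

lemma pm_push_scale:
  fixes f :: "'m::monoid_add \<Rightarrow> 'n::monoid_add" and c :: "'c::comm_ring_1"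
  shows "pm_push f (pm_scale c p) = pm_scale c (pm_push f p)"
proof -
  have "pm_push f (pm_scale c p) = (\<Sum>x\<in>keys p. single (f x) (lookup (pm_scale c p) x))"
    by (rule pm_push_superset) (auto simp: in_keys_iff lookup_pm_scale)
  then show ?thesis
    by (simp add: pm_push_def lookup_pm_scale sum_distrib_left mult_single)
qed

lemma pm_push_mult:
  fixes f :: "'m::monoid_add \<Rightarrow> 'n::monoid_add" and p q :: "'m \<Rightarrow>\<^sub>0 'c::comm_ring_1"
  assumes "\<And>x y. f (x + y) = f x + f y"
  shows "pm_push f (p * q) = pm_push f p * pm_push f q"
proof -
  have "pm_push f ((\<Sum>x\<in>keys p. single x (lookup p x)) * (\<Sum>y\<in>keys q. single y (lookup q y)))
      = pm_push f p * pm_push f q"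
    unfolding sum_product
    by (simp add: pm_push_sum mult_single pm_push_single assms)
      (simp add: pm_push_def sum_product mult_single)
  then show ?thesis by (simp only: poly_mapping_sum_single[symmetric])
qed

lemma map_word_add: "map_word f (v + w) = map_word f v + map_word f w"
  by (cases v; cases w) (simp add: plus_word_def)

locale B2_endomorphism =
  fixes \<phi> :: "'k::field B2 \<Rightarrow> 'k B2"
  assumes add: "\<phi> (x + y) = \<phi> x + \<phi> y"
    and scale: "\<phi> (B2_scale c x) = B2_scale c (\<phi> x)"
    and bracket: "\<phi> (B2_bracket x y) = B2_bracket (\<phi> x) (\<phi> y)"
begin

abbreviation push where "push \<equiv> pm_push (map_word \<phi>) :: ('k B2 word \<Rightarrow>\<^sub>0 'k) \<Rightarrow> _"

lemma push_mult: "push (p * q) = push p * push q"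
  by (rule pm_push_mult) (rule map_word_add)

lemma push_relations:
  assumes "s \<in> uea_relations B2_scale B2_bracket"
  shows "push s \<in> uea_relations B2_scale B2_bracket"
  using assms unfolding uea_relations_def
  by (elim UnE CollectE exE conjE)
    (simp_all only: pm_push_diff pm_push_single word.map list.map add scale bracket, blast+)

lemma push_ideal:
  "p \<in> two_sided_ideal (uea_relations B2_scale B2_bracket) \<Longrightarrow>
    push p \<in> two_sided_ideal (uea_relations B2_scale B2_bracket)"
  by (induction rule: two_sided_ideal.induct)
    (simp_all add: two_sided_ideal.zero pm_push_add push_mult push_relations two_sided_ideal.step)

text \<open>\<open>UB2_map\<close> works on a chosen representative; since letterwise substitution
  preserves the ideal, any representative gives the same class.\<close>

lemma UB2_map_abs: "UB2_map \<phi> (abs_UB2 p) = abs_UB2 (push p)"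
proof -
  have "UB2_eq (rep_UB2 (abs_UB2 p)) p"
    unfolding UB2.abs_eq_iff[symmetric] by (rule Quotient3_abs_rep[OF Quotient3_UB2])
  then show ?thesis
    by (simp add: UB2_map_def UB2.abs_eq_iff UB2_eq_def push_ideal flip: pm_push_diff)
qed

lemma UB2_map_add: "UB2_map \<phi> (x + y) = UB2_map \<phi> x + UB2_map \<phi> y"
  by (induction x rule: UB2.abs_induct, induction y rule: UB2.abs_induct)
    (simp add: UB2_map_abs plus_UB2.abs_eq pm_push_add)

lemma UB2_map_mult: "UB2_map \<phi> (x * y) = UB2_map \<phi> x * UB2_map \<phi> y"
  by (induction x rule: UB2.abs_induct, induction y rule: UB2.abs_induct)
    (simp add: UB2_map_abs times_UB2.abs_eq push_mult)

lemma UB2_map_scalar: "UB2_map \<phi> (UB2_scalar c) = UB2_scalar c"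
  by (simp add: UB2_scalar.abs_eq UB2_map_abs pm_push_single zero_word_def)

lemma UB2_map_incl: "UB2_map \<phi> (UB2_incl x) = UB2_incl (\<phi> x)"
  by (simp add: UB2_incl.abs_eq UB2_map_abs pm_push_single)

lemma UB2_map_zero: "UB2_map \<phi> 0 = 0"
  using UB2_map_add[of 0 0] by simp

lemma UB2_map_sum: "UB2_map \<phi> (sum f A) = (\<Sum>x\<in>A. UB2_map \<phi> (f x))"
  by (induction A rule: infinite_finite_induct) (simp_all add: UB2_map_add UB2_map_zero)

lemma Ut_map_add: "Ut_map \<phi> (f + g) = Ut_map \<phi> f + Ut_map \<phi> g"
  by (rule fps_ext) (simp add: Ut_map_def UB2_map_add)

lemma Ut_map_mult: "Ut_map \<phi> (f * g) = Ut_map \<phi> f * Ut_map \<phi> g"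
  by (rule fps_ext) (simp add: Ut_map_def fps_mult_nth UB2_map_mult UB2_map_sum)

lemma Ut_map_scalar: "Ut_map \<phi> (Ut_scalar c) = Ut_scalar c"
  by (rule fps_ext) (simp add: Ut_map_def Ut_scalar_def UB2_map_scalar)

lemma Ut_map_const: "Ut_map \<phi> (fps_const x) = fps_const (UB2_map \<phi> x)"
  by (rule fps_ext) (simp add: Ut_map_def UB2_map_zero)

lemma Ut_map_X: "Ut_map \<phi> fps_X = fps_X"
  using Ut_map_scalar[of fps_X] by (simp only: Ut_scalar_X)

lemma Ut_map_one: "Ut_map \<phi> 1 = 1"
  using Ut_map_scalar[of 1] by (simp only: Ut.map_one)

lemma Ut_map_power: "Ut_map \<phi> (f ^ n) = Ut_map \<phi> f ^ n"
  by (induction n) (simp_all add: Ut_map_one Ut_map_mult)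

lemma Ut_map_zero: "Ut_map \<phi> 0 = 0"
  using Ut_map_add[of 0 0] by simp

lemma Ut_map_poly_at: "Ut_map \<phi> (Ut0.poly_at h p) = Ut0.poly_at (Ut_map \<phi> h) p"
  by (induction p) (simp_all add: Ut_map_zero Ut_map_add Ut_map_mult Ut_map_scalar)

end

text \<open>Linearity over the power series in t sends each tensor relation to one of the same kind,
  so the pair descends to the tensor product.\<close>

locale Ut_linear_pair =
  fixes f g :: "'k::field Ut \<Rightarrow> 'k Ut"
  assumes f_add: "f (x + y) = f x + f y" and f_scale: "f (Ut_scalar c * x) = Ut_scalar c * f x"
    and g_add: "g (x + y) = g x + g y" and g_scale: "g (Ut_scalar c * x) = Ut_scalar c * g x"
begin

lemma pm_push_relations:
  assumes "s \<in> tensor_relations Ut_scalar Ut_scalar"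
  shows "pm_push (map_mpair f g) s \<in> tensor_relations Ut_scalar Ut_scalar"
  using assms
  by (cases rule: tensor_relationsE)
    (simp_all only: pm_push_diff pm_push_single mpair.map f_add f_scale g_add g_scale tensor_relationsI)

lemma pm_push_null:
  "p \<in> tensor_null Ut_scalar Ut_scalar \<Longrightarrow>
    pm_push (map_mpair f g) p \<in> tensor_null Ut_scalar Ut_scalar"
  unfolding tensor_null_def
proof (induction rule: pm.span_induct_alt)
  case (step c s q)
  then show ?case
    by (simp add: pm_push_add pm_push_scale pm.span_add pm.span_scale pm.span_base
        pm_push_relations)
qed (simp add: pm.span_zero)

lemma Utensor_map_abs:
  "Utensor_map f g (abs_Utensor p) = abs_Utensor (pm_push (map_mpair f g) p)"
proof -
  have "Utensor_eq (rep_Utensor (abs_Utensor p)) p"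
    unfolding Utensor.abs_eq_iff[symmetric] by (rule Quotient3_abs_rep[OF Quotient3_Utensor])
  then show ?thesis
    by (simp add: Utensor_map_def Utensor.abs_eq_iff Utensor_eq_def pm_push_null flip: pm_push_diff)
qed

lemma Utensor_map_add: "Utensor_map f g (x + y) = Utensor_map f g x + Utensor_map f g y"
  by (induction x rule: Utensor.abs_induct, induction y rule: Utensor.abs_induct)
    (simp add: Utensor_map_abs plus_Utensor.abs_eq pm_push_add)

lemma Utensor_map_diff: "Utensor_map f g (x - y) = Utensor_map f g x - Utensor_map f g y"
  using Utensor_map_add[of "x - y" y] by simp

lemma Utensor_map_zero: "Utensor_map f g 0 = 0"
  using Utensor_map_add[of 0 0] by simp

lemma Utensor_map_sum: "Utensor_map f g (sum h A) = (\<Sum>x\<in>A. Utensor_map f g (h x))"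
  by (induction A rule: infinite_finite_induct) (simp_all add: Utensor_map_add Utensor_map_zero)

lemma Utensor_map_scale: "Utensor_map f g (Utensor_scalar c * x) = Utensor_scalar c * Utensor_map f g x"
  by (induction x rule: Utensor.abs_induct)
    (simp add: Utensor_map_abs Utensor_scalar.abs_eq times_Utensor.abs_eq pm_push_scale)

lemma Utensor_map_pure: "Utensor_map f g (Utensor_pure a b) = Utensor_pure (f a) (g b)"
  by (simp add: Utensor_pure_def Utensor_map_abs pm_push_single)

text \<open>Linearity already gives t-adic continuity, as t^n is a scalar; hence the map passes to
  the completion.\<close>

lemma adic_close_Utensor_map:
  assumes "adic_close Utensor_t n x y"
  shows "adic_close Utensor_t n (Utensor_map f g x) (Utensor_map f g y)"
  using assms unfolding adic_close_def
  by (metis Utensor_map_diff Utensor_map_scale Utensor.map_power)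

lemma Uctensor_map_abs:
  assumes "Uctensor_eq s s"
  shows "Uctensor_map f g (abs_Uctensor s) = abs_Uctensor (\<lambda>i. Utensor_map f g (s i))"
proof -
  have "Uctensor_eq (rep_Uctensor (abs_Uctensor s)) s"
    using assms by (metis Quotient3_rep_abs[OF Quotient3_Uctensor])
  then have "Uctensor_eq (\<lambda>i. Utensor_map f g (rep_Uctensor (abs_Uctensor s) i))
      (\<lambda>i. Utensor_map f g (s i))"
    \<comment> \<open>The unary map is treated as a binary operation that ignores its second
      argument, which is fed a constant sequence.\<close>
    by (intro Uctensor_eq_binop[where f = "\<lambda>x y. Utensor_map f g x", OF _ _ Uctensor_eq_const])
      (rule adic_close_Utensor_map)
  then show ?thesis
    unfolding Uctensor_map_def map_fun_apply by (rule Quotient3_rel_abs[OF Quotient3_Uctensor])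
qed

end


section \<open>The Jordanian twist\<close>

lemma Ut_linear_pair_Ut_map:
  assumes "B2_endomorphism \<phi>"
  shows "Ut_linear_pair (Ut_map \<phi>) (Ut_map \<phi>)"
proof -
  interpret B2_endomorphism \<phi> by fact
  show ?thesis by unfold_locales (simp_all add: Ut_map_add Ut_map_mult Ut_map_scalar)
qed

text \<open>The map acts term by term on the partial sums, so the two representing sequences are
  equal entry by entry.\<close>

lemma Uctensor_map_poly_series:
  assumes "B2_endomorphism \<phi>" and H: "\<phi> B2_H = B2_H"
  shows "Uctensor_map (Ut_map \<phi>) (Ut_map \<phi>) (poly_series e p) = poly_series (UB2_map \<phi> e) p"
proof -
  interpret B2_endomorphism \<phi> by fact
  interpret Ut_linear_pair "Ut_map \<phi>" "Ut_map \<phi>" by (rule Ut_linear_pair_Ut_map) fact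
  have "Ut_map \<phi> Ut_H = Ut_H"
    by (simp add: Ut_H_def Ut_map_const UB2_H_def UB2_map_incl H)
  then have "Utensor_map (Ut_map \<phi>) (Ut_map \<phi>) (t_partial_sum (poly_tensor e p) n)
      = t_partial_sum (poly_tensor (UB2_map \<phi> e) p) n" for n
    by (simp add: t_power_poly_tensor Utensor_map_sum Utensor_map_pure Ut_map_poly_at
        Ut_map_power Ut_map_mult Ut_map_const Ut_map_X)
  then show ?thesis
    by (simp add: poly_series_def Uctensor_map_abs Uctensor_eq_t_partial_sum)
qed

lemma UB2_incl_add: "UB2_incl (x + y) = UB2_incl x + UB2_incl y"
proof transfer
  fix x y :: "'a B2"
  have "single (Word [x + y]) 1 - single (Word [x]) 1 - single (Word [y]) 1
      \<in> (uea_relations B2_scale B2_bracket :: ('a B2 word \<Rightarrow>\<^sub>0 'a) set)"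
    unfolding uea_relations_def by blast
  from two_sided_ideal.step[OF two_sided_ideal.zero this, of 1 1]
  show "UB2_eq (single (Word [x + y]) 1) (single (Word [x]) (1 :: 'a) + single (Word [y]) 1)"
    by (simp add: UB2_eq_def diff_diff_eq)
qed

lemma UB2_incl_uminus: "UB2_incl (- x) = - UB2_incl x"
proof -
  have "UB2_incl 0 = (0 :: 'a UB2)" using UB2_incl_add[of "0 :: 'a B2" 0] by simp
  with UB2_incl_add[of x "- x"] show ?thesis by (simp add: eq_neg_iff_add_eq_0 add.commute)
qed

lemma lie_automorphism_imp_B2_endomorphism:
  assumes "lie_automorphism B2_scale B2_bracket \<phi>"
  shows "B2_endomorphism \<phi>"
proof -
  interpret Vector_Spaces.linear B2_scale B2_scale \<phi>
    using assms by (simp add: lie_automorphism_def)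
  show ?thesis
    using assms unfolding lie_automorphism_def by unfold_locales (blast intro: add scale)+
qed

text \<open>Keeps the claim about all such automorphisms from being vacuous. The witness negates the
  E-coordinate and is bijective as an involution.\<close>

lemma ex_lie_automorphism_uminus_E:
  "\<exists>\<phi> :: 'k::field B2 \<Rightarrow> 'k B2. lie_automorphism B2_scale B2_bracket \<phi> \<and>
    \<phi> B2_H = B2_H \<and> \<phi> B2_E = - B2_E"
proof (intro exI conjI)
  let ?\<phi> = "\<lambda>x :: 'k B2. (fst x, - snd x)"
  interpret lie_algebra "B2_scale :: 'k \<Rightarrow> _" B2_bracket by (rule B2_lie_algebra)
  have "Vector_Spaces.linear B2_scale B2_scale ?\<phi>"
    by unfold_locales (simp_all add: B2_scale_def)
  moreover have "bij ?\<phi>"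
    by (rule involuntory_imp_bij) simp
  ultimately show "lie_automorphism B2_scale B2_bracket ?\<phi>"
    by (simp add: lie_automorphism_def B2_bracket_def)
qed (simp_all add: B2_H_def B2_E_def)

lemma Ut_E_power_times_t_power: "Ut_E ^ r * Ut_t ^ r = (fps_const UB2_E * fps_X) ^ r"
  by (simp add: Ut_E_def fps_const_times_X_power fps_mult_fps_X_power_commute)

text \<open>The sign (-1)^r is a scalar and can be absorbed by the right factor, turning e^r into
  (-e)^r; so \<open>jordanian_twist\<close> is the binomial series at -E.\<close>

lemma twist_term_uminus:
  "Uctensor_scalar ((- 1) ^ r / fact r) * (a \<otimes> (fps_const e * fps_X) ^ r)
    = Uctensor_scalar (1 / fact r) * (a \<otimes> (fps_const (- e) * fps_X) ^ r)"
  for e :: "'k::field_char_0 UB2"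
proof -
  have "(fps_const (- e) * fps_X) ^ r = (- 1) ^ r * (fps_const e * fps_X) ^ r"
    by (simp add: power_minus[of "fps_const e * fps_X"] flip: fps_const_neg)
  also have "(- 1) ^ r = Ut_scalar0 ((- 1 :: 'k) ^ r)"
    by (simp only: Ut0.map_power Ut0.map_uminus Ut0.map_one)
  finally have "a \<otimes> (fps_const (- e) * fps_X) ^ r
      = (Ut_scalar0 ((- 1) ^ r) * a) \<otimes> (fps_const e * fps_X) ^ r"
    by (simp add: Uctensor_pure_def flip: Utensor_scalar_times_pure_left Utensor_scalar_times_pure_right)
  then show ?thesis
    by (simp add: Uctensor_scalar_times_pure mult.assoc[symmetric] flip: Ut0.map_mult)
qed

lemma canonical_jordanian_twist_eq: "canonical_jordanian_twist = poly_series UB2_E binom_poly"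
  unfolding canonical_jordanian_twist_def Ut_E_def by (rule formal_exp_ln1p)

lemma jordanian_twist_sums:
  "(\<lambda>r. Uctensor_scalar ((- 1) ^ r / fact r) * (falling Ut_H r \<otimes> (Ut_E ^ r * Ut_t ^ r)))
    sums poly_series (- UB2_E) binom_poly"
  unfolding Ut_E_power_times_t_power twist_term_uminus by (rule binom_poly_series_sums)

lemma jordanian_twist_eq: "jordanian_twist = poly_series (- UB2_E) binom_poly"
  unfolding jordanian_twist_def by (rule sums_unique[symmetric]) (rule jordanian_twist_sums)

theorem mainTheorem9:
  "let H = Ut_H :: 'k::field_char_0 Ut; E = Ut_E; t = Ut_t; \<eta> = Uctensor_scalar;
       lnp = formal_ln1p Ut_scalar0 (E * t); lnm = formal_ln1p Ut_scalar0 (- (E * t));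
       FJ = canonical_jordanian_twist; F = jordanian_twist
   in formal_ln1p_converges Ut_scalar0 (E * t) \<and> formal_exp_converges \<eta> (H \<otimes> lnp) \<and>
      formal_ln1p_converges Ut_scalar0 (- (E * t)) \<and> formal_exp_converges \<eta> (H \<otimes> lnm) \<and>
      (\<lambda>r. \<eta> (1 / fact r) * (falling H r \<otimes> (E ^ r * t ^ r))) sums FJ \<and>
      (\<exists>G. (\<lambda>r. \<eta> ((- 1) ^ r / fact r) * (rising H r \<otimes> (E ^ r * t ^ r))) sums G \<and>
           FJ * G = 1 \<and> G * FJ = 1) \<and>
      (\<lambda>r. \<eta> ((- 1) ^ r / fact r) * (falling H r \<otimes> (E ^ r * t ^ r))) sums F \<and>
      F = formal_exp \<eta> (H \<otimes> lnm) \<and>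
      (\<exists>\<phi> :: 'k B2 \<Rightarrow> 'k B2. lie_automorphism B2_scale B2_bracket \<phi> \<and>
           \<phi> B2_H = B2_H \<and> \<phi> B2_E = - B2_E) \<and>
      (\<forall>\<phi> :: 'k B2 \<Rightarrow> 'k B2. lie_automorphism B2_scale B2_bracket \<phi> \<and>
           \<phi> B2_H = B2_H \<and> \<phi> B2_E = - B2_E \<longrightarrow>
           F = Uctensor_map (Ut_map \<phi>) (Ut_map \<phi>) FJ)"
proof -
  let ?\<eta> = "Uctensor_scalar :: 'k \<Rightarrow> _" and ?E = "UB2_E :: 'k UB2"
  \<comment> \<open>The second equation makes ln(1 - E t) the instance e = -E of ln(1 + e
    t).\<close>
  have E: "Ut_E * Ut_t = fps_const ?E * fps_X" "- (fps_const ?E * fps_X) = fps_const (- ?E) * fps_X"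
    by (simp_all add: Ut_E_def flip: fps_const_neg)
  have FJ: "(\<lambda>r. ?\<eta> (1 / fact r) * (falling Ut_H r \<otimes> (Ut_E ^ r * Ut_t ^ r))) sums canonical_jordanian_twist"
    unfolding Ut_E_power_times_t_power canonical_jordanian_twist_eq
    by (rule binom_poly_series_sums)
  have G: "\<exists>G. (\<lambda>r. ?\<eta> ((- 1) ^ r / fact r) * (rising Ut_H r \<otimes> (Ut_E ^ r * Ut_t ^ r))) sums G \<and>
      canonical_jordanian_twist * G = 1 \<and> G * canonical_jordanian_twist = 1"
    unfolding Ut_E_power_times_t_power canonical_jordanian_twist_eq
    using neg_binom_poly_series_sums binom_poly_series_inverse by blast
  have map: "jordanian_twist = Uctensor_map (Ut_map \<phi>) (Ut_map \<phi>) canonical_jordanian_twist"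
    if "lie_automorphism B2_scale B2_bracket \<phi>" "\<phi> B2_H = B2_H" "\<phi> B2_E = - B2_E"
    for \<phi> :: "'k B2 \<Rightarrow> 'k B2"
  proof -
    interpret B2_endomorphism \<phi>
      using that(1) by (rule lie_automorphism_imp_B2_endomorphism)
    have "UB2_map \<phi> UB2_E = - UB2_E"
      by (simp add: UB2_E_def UB2_map_incl that UB2_incl_uminus)
    then show ?thesis
      by (simp add: jordanian_twist_eq canonical_jordanian_twist_eq Uctensor_map_poly_series
          B2_endomorphism_axioms that)
  qed
  show ?thesis
    unfolding Let_def E
    by (intro conjI allI impI FJ G ex_lie_automorphism_uminus_E formal_ln1p_eq(2) formal_exp_ln1p(2)
        jordanian_twist_sums[folded jordanian_twist_eq]
        trans[OF jordanian_twist_eq formal_exp_ln1p(1)[symmetric]]) (elim conjE, rule map)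
qed

end
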